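(* Let $H$ be a (not necessarily semibounded) self-adjoint operator with bounded inverse in a Hilbert space $\mathcal{H}$, let $\mathcal{U}$ be a finite dimensional subspace of $\operatorname{Dom}(H)$, let $M = P_{\mathcal{U}} H|_{\mathcal{U}}$ be the compression of $H$ to $\mathcal{U}$ with eigenvalues $\mu_1 \leq \dots \leq \mu_m$ (counting multiplicities), $m = \dim \mathcal{U}$, and let $P$ be the projection in $\mathcal{H}$ onto $\mathcal{V} = \operatorname{Ran} H|_{\mathcal{U}}$ along the orthogonal complement $\mathcal{W}^\perp$ of $\mathcal{W} = \operatorname{Ran} H^{-1}|_{\mathcal{U}}$. Suppose that $\eta := \lVert P_{\mathcal{U}} - P \rVert < 1$. Then: (a) $M$ is invertible. (b) If numbers $m_0, m_1 \in \mathbb{N}$ with $m_0 \leq m_1 \leq \dim \mathcal{U}$ satisfy $\mu_{m_0} > 0$ and $\mu_{m_1} < (1-\eta) d$, where $d := \inf(\sigma_{\mathrm{ess}}(H) \cap (0,\infty)) \in (0,\infty]$, then $H$ has at least $m_1 - m_0 + 1$ positive eigenvalues below $d$, counting multiplicities, and there are indices $j_{m_0} < \dots < j_{m_1}$ with $$\frac{\lvert \lambda_{j_k} - \mu_k \rvert}{\lambda_{j_k}} \leq \eta \quad \text{for all } m_0 \leq k \leq m_1,$$ where $\lambda_j$ denotes the $j$-th positive eigenvalue of $H$ below $d$.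
   Context: $P_{\mathcal{U}}$ denotes the orthogonal projection in $\mathcal{H}$ onto $\mathcal{U}$. The compression $M = P_{\mathcal{U}} H|_{\mathcal{U}} \colon \mathcal{U} \to \mathcal{U}$ is a self-adjoint operator in the finite dimensional Hilbert space $\mathcal{U}$. $\operatorname{Ran} H|_{\mathcal{U}} = \{Hu : u \in \mathcal{U}\}$ and $\operatorname{Ran} H^{-1}|_{\mathcal{U}} = \{H^{-1}u : u \in \mathcal{U}\}$. The projection $P$ (in general non-orthogonal, with range $\mathcal{V}$ and kernel $\mathcal{W}^\perp$) always exists and is given by $P = H P_{\mathcal{U}} H^{-1}$. $\sigma_{\mathrm{ess}}(H)$ is the essential spectrum of $H$, and $\inf \emptyset = \infty$. $\lambda_j \in (0,\infty)$ denotes the $j$-th positive eigenvalue of $H$ below $d = \inf(\sigma_{\mathrm{ess}}(H) \cap (0,\infty))$, in increasing order and counting multiplicities, provided that this eigenvalue exists. $\mathbb{N} = \{1,2,\dots\}$. *)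

theory Defs
  imports "HOL-Analysis.Analysis"
begin

class complex_inner = real_normed_vector +
  fixes scaleC :: "complex \<Rightarrow> 'a \<Rightarrow> 'a" (infixr "*\<^sub>C" 75)
    and cinner :: "'a \<Rightarrow> 'a \<Rightarrow> complex"
  assumes scaleC_add_right: "a *\<^sub>C (x + y) = a *\<^sub>C x + a *\<^sub>C y"
    and scaleC_add_left: "(a + b) *\<^sub>C x = a *\<^sub>C x + b *\<^sub>C x"
    and scaleC_scaleC: "a *\<^sub>C (b *\<^sub>C x) = (a * b) *\<^sub>C x"
    and scaleR_scaleC: "scaleR r x = complex_of_real r *\<^sub>C x"
    and cinner_commute: "cinner x y = cnj (cinner y x)"
    and cinner_add_left: "cinner (x + y) z = cinner x z + cinner y z"
    and cinner_scaleC_left: "cinner (a *\<^sub>C x) y = cnj a * cinner x y"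
    and cinner_ge_zero: "0 \<le> Re (cinner x x)"
    and cinner_eq_zero_iff: "cinner x x = 0 \<longleftrightarrow> x = 0"
    and norm_eq_sqrt_cinner: "norm x = sqrt (Re (cinner x x))"

class chilbert_space = complex_inner + complete_space

global_interpretation complex_vector: vector_space "scaleC :: complex \<Rightarrow> 'a \<Rightarrow> 'a::complex_inner"
proof
  fix x :: 'a
  show "1 *\<^sub>C x = x"
    using scaleR_scaleC[of 1 x] by simp
qed (simp_all add: scaleC_add_right scaleC_add_left scaleC_scaleC)

definition finite_dimensional :: "'a::complex_inner set \<Rightarrow> bool" where
  "finite_dimensional S \<longleftrightarrow> (\<exists>B. finite B \<and> S \<subseteq> complex_vector.span B)"

definition orthogonal_complement :: "'a::complex_inner set \<Rightarrow> 'a set" where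
  "orthogonal_complement S = {x. \<forall>y\<in>S. cinner y x = 0}"

(* Meaningful when the whole space is the direct sum of the subspaces V and K. *)
definition projection_along :: "'a::complex_inner set \<Rightarrow> 'a set \<Rightarrow> 'a \<Rightarrow> 'a" where
  "projection_along V K x = (THE v. v \<in> V \<and> x - v \<in> K)"

definition orthogonal_projection :: "'a::complex_inner set \<Rightarrow> 'a \<Rightarrow> 'a" where
  "orthogonal_projection V = projection_along V (orthogonal_complement V)"

(* An operator is a pair of a domain D and a total function T of which only the values on D
   are used. *)

definition linear_operator :: "'a::complex_inner set \<Rightarrow> ('a \<Rightarrow> 'a) \<Rightarrow> bool" where
  "linear_operator D T \<longleftrightarrow> complex_vector.subspace D
     \<and> (\<forall>x\<in>D. \<forall>y\<in>D. T (x + y) = T x + T y)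
     \<and> (\<forall>c. \<forall>x\<in>D. T (c *\<^sub>C x) = c *\<^sub>C T x)"

definition adjoint_graph :: "'a::complex_inner set \<Rightarrow> ('a \<Rightarrow> 'a) \<Rightarrow> ('a \<times> 'a) set" where
  "adjoint_graph D T = {(y, z). \<forall>x\<in>D. cinner y (T x) = cinner z x}"

definition self_adjoint :: "'a::complex_inner set \<Rightarrow> ('a \<Rightarrow> 'a) \<Rightarrow> bool" where
  "self_adjoint D T \<longleftrightarrow> linear_operator D T \<and> closure D = UNIV
     \<and> adjoint_graph D T = (\<lambda>x. (x, T x)) ` D"

definition has_bounded_inverse :: "'a::complex_inner set \<Rightarrow> ('a \<Rightarrow> 'a) \<Rightarrow> bool" where
  "has_bounded_inverse D T \<longleftrightarrow> bij_betw T D UNIV \<and> bounded_linear (inv_into D T)"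

definition spectrum :: "'a::complex_inner set \<Rightarrow> ('a \<Rightarrow> 'a) \<Rightarrow> complex set" where
  "spectrum D T = {z. \<not> has_bounded_inverse D (\<lambda>x. T x - z *\<^sub>C x)}"

definition eigenspace :: "'a::complex_inner set \<Rightarrow> ('a \<Rightarrow> 'a) \<Rightarrow> complex \<Rightarrow> 'a set" where
  "eigenspace D T z = {x \<in> D. T x = z *\<^sub>C x}"

definition is_eigenvalue :: "'a::complex_inner set \<Rightarrow> ('a \<Rightarrow> 'a) \<Rightarrow> complex \<Rightarrow> bool" where
  "is_eigenvalue D T z \<longleftrightarrow> (\<exists>x\<in>eigenspace D T z. x \<noteq> 0)"

definition discrete_spectrum :: "'a::complex_inner set \<Rightarrow> ('a \<Rightarrow> 'a) \<Rightarrow> complex set" where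
  "discrete_spectrum D T = {z. is_eigenvalue D T z \<and> finite_dimensional (eigenspace D T z)
     \<and> z isolated_in spectrum D T}"

definition essential_spectrum :: "'a::complex_inner set \<Rightarrow> ('a \<Rightarrow> 'a) \<Rightarrow> complex set" where
  "essential_spectrum D T = spectrum D T - discrete_spectrum D T"

(* Geometric multiplicity, which for self-adjoint operators is the multiplicity. *)
definition multiplicity_of :: "'a::complex_inner set \<Rightarrow> ('a \<Rightarrow> 'a) \<Rightarrow> real \<Rightarrow> nat" where
  "multiplicity_of D T t = complex_vector.dim (eigenspace D T (complex_of_real t))"

definition real_eigenvalues :: "'a::complex_inner set \<Rightarrow> ('a \<Rightarrow> 'a) \<Rightarrow> real set" where
  "real_eigenvalues D T = {t. is_eigenvalue D T (complex_of_real t)}"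

definition positive_eigenvalues_below ::
  "'a::complex_inner set \<Rightarrow> ('a \<Rightarrow> 'a) \<Rightarrow> ereal \<Rightarrow> real set" where
  "positive_eigenvalues_below D T d = {t \<in> real_eigenvalues D T. 0 < t \<and> ereal t < d}"

(* For a set E of eigenvalues of T with {s \<in> E. s \<le> t} finite for every t \<in> E: the j-th
   element (j = 1, 2, ...) of E in increasing order, counting multiplicities. It exists iff
   1 \<le> j \<le> eigenvalue_count D T E. *)
definition nth_eigenvalue ::
  "'a::complex_inner set \<Rightarrow> ('a \<Rightarrow> 'a) \<Rightarrow> real set \<Rightarrow> nat \<Rightarrow> real" where
  "nth_eigenvalue D T E j = (THE t. t \<in> E
     \<and> (\<Sum>s\<in>{s \<in> E. s < t}. multiplicity_of D T s) < j
     \<and> j \<le> (\<Sum>s\<in>{s \<in> E. s \<le> t}. multiplicity_of D T s))"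

definition eigenvalue_count ::
  "'a::complex_inner set \<Rightarrow> ('a \<Rightarrow> 'a) \<Rightarrow> real set \<Rightarrow> enat" where
  "eigenvalue_count D T E =
     (SUP F\<in>{F. finite F \<and> F \<subseteq> E}. enat (\<Sum>s\<in>F. multiplicity_of D T s))"

end

theory Submission
  imports Defs
begin

text \<open>
  Let \<open>Q\<close> be the orthogonal projection onto \<open>U\<close>. Since \<open>P\<close> fixes \<open>H u\<close> for \<open>u\<close> in \<open>U\<close>, one has
  \<open>(Q - P) H u = M u - H u\<close>, so the definition of \<open>\<eta>\<close> gives the residual bound
  \<open>\<parallel>H u - M u\<parallel> \<le> \<eta> \<parallel>H u\<parallel>\<close> on \<open>U\<close>. Moreover \<open>H u - M u\<close> is orthogonal to \<open>U\<close>. Everything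
  else follows from these two facts. If \<open>M u = 0\<close>, the bound forces \<open>H u = 0\<close>, which gives
  the invertibility of \<open>M\<close>.

  The core is a count of eigenvalues (\<open>compression_eigenvalue_count\<close>): for \<open>0 < p \<le> q\<close>, put
  \<open>\<alpha> = p / (1 + \<eta>)\<close> and \<open>\<beta> = q / (1 - \<eta>)\<close>; if \<open>[\<alpha>, \<beta>]\<close> misses the essential spectrum, then \<open>H\<close> has
  at least as many eigenvalues in \<open>[\<alpha>, \<beta>]\<close> as \<open>M\<close> has in \<open>[p, q]\<close>. Otherwise some nonzero \<open>x\<close> in
  the span of the eigenvectors of \<open>M\<close> for \<open>[p, q]\<close> is orthogonal to all eigenvectors of \<open>H\<close> for
  \<open>[\<alpha>, \<beta>]\<close>. Then \<open>\<langle>(H - \<alpha>) x, (H - \<beta>) x\<rangle> > 0\<close>, because off these eigenvectors \<open>H\<close> has no spectrum in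
  \<open>[\<alpha>, \<beta>]\<close>. On the other hand, with \<open>m = \<langle>M x, x\<rangle> = \<langle>H x, x\<rangle> \<ge> 0\<close>, Pythagoras and the residual
  bound give \<open>(1 - \<eta>\<^sup>2) \<parallel>H x\<parallel>\<^sup>2 \<le> \<parallel>M x\<parallel>\<^sup>2 \<le> (p + q) m - p q \<parallel>x\<parallel>\<^sup>2\<close>, and inserting this yields
  \<open>(1 - \<eta>\<^sup>2) \<langle>(H - \<alpha>) x, (H - \<beta>) x\<rangle> \<le> - \<eta> (q - p) m \<le> 0\<close>, a contradiction.

  Applied to all intervals \<open>[\<mu>\<^sub>a, \<mu>\<^sub>k]\<close> with \<open>m\<^sub>0 \<le> a \<le> k \<le> m\<^sub>1\<close>, the count is a Hall condition for
  intervals with increasing end points, and \<open>strict_mono_selection\<close> turns it into increasing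
  indices \<open>j\<^sub>k\<close> with \<open>\<mu>\<^sub>k / (1 + \<eta>) \<le> \<lambda> \<le> \<mu>\<^sub>k / (1 - \<eta>)\<close> for the \<open>j\<^sub>k\<close>-th eigenvalue \<open>\<lambda>\<close>.

  The positivity of \<open>\<langle>(H - \<alpha>) x, (H - \<beta>) x\<rangle>\<close> is obtained without the spectral theorem. The condition
  \<open>\<langle>(T - a) x, (T - b) x\<rangle> \<ge> 0\<close> on a domain, called a spectral gap below, expresses that \<open>T\<close> has no
  spectrum in \<open>(a, b)\<close>. Two adjacent gaps merge across a point \<open>t\<close> as soon as \<open>T - t\<close> has dense
  range (\<open>spectral_gap_merge\<close>), points of the resolvent set have small gaps around them, and so do
  isolated eigenvalues once their eigenvectors are split off. Bisection glues the small gaps to a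
  gap on a whole compact interval. The same gluing, on an interval wider than the norm bound,
  shows that a symmetric operator on a finite dimensional space has an eigenvector.
\<close>

section \<open>Inner product geometry and projection onto a closed subspace\<close>

text \<open>
  The real part of the complex inner product: the gap inequalities and their polarization
  only need the underlying real Hilbert space.
\<close>
definition ip :: "'a::complex_inner \<Rightarrow> 'a \<Rightarrow> real" where
  "ip x y = Re (cinner x y)"

lemma cinner_add_right: "cinner x (y + z) = cinner x y + cinner x z"
  by (metis cinner_add_left cinner_commute complex_cnj_add)

lemma cinner_scaleC_right: "cinner x (a *\<^sub>C y) = a * cinner x y"
  by (metis cinner_commute cinner_scaleC_left complex_cnj_cnj complex_cnj_mult)

lemma cinner_zero_left [simp]: "cinner 0 y = 0"
  using cinner_scaleC_left[of 0 0 y] by simp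

lemma cinner_zero_right [simp]: "cinner y 0 = 0"
  using cinner_scaleC_right[of y 0 0] by simp

lemma cinner_minus_left [simp]: "cinner (- x) y = - cinner x y"
  using cinner_add_left[of x "- x" y] by (simp add: eq_neg_iff_add_eq_0 add.commute)

lemma cinner_minus_right [simp]: "cinner x (- y) = - cinner x y"
  using cinner_add_right[of x y "- y"] by (simp add: eq_neg_iff_add_eq_0 add.commute)

lemma cinner_diff_left: "cinner (x - y) z = cinner x z - cinner y z"
  using cinner_add_left[of x "- y" z] by simp

lemma cinner_diff_right: "cinner x (y - z) = cinner x y - cinner x z"
  using cinner_add_right[of x y "- z"] by simp

lemma cinner_sum_left: "cinner (\<Sum>i\<in>I. f i) y = (\<Sum>i\<in>I. cinner (f i) y)"
  by (induction I rule: infinite_finite_induct) (auto simp: cinner_add_left)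

lemma cinner_sum_right: "cinner y (\<Sum>i\<in>I. f i) = (\<Sum>i\<in>I. cinner y (f i))"
  by (induction I rule: infinite_finite_induct) (auto simp: cinner_add_right)

lemma cinner_scaleR_left [simp]: "cinner (r *\<^sub>R x) y = of_real r * cinner x y"
  by (simp add: scaleR_scaleC cinner_scaleC_left)

lemma cinner_scaleR_right [simp]: "cinner x (r *\<^sub>R y) = of_real r * cinner x y"
  by (simp add: scaleR_scaleC cinner_scaleC_right)

lemmas cinner_algebra = cinner_add_left cinner_add_right cinner_diff_left cinner_diff_right
  cinner_scaleC_left cinner_scaleC_right

lemma cinner_self: "cinner x x = of_real ((norm x)\<^sup>2)"
proof -
  have "Im (cinner x x) = 0"
    using arg_cong[OF cinner_commute[of x x], of Im] by simp
  then show ?thesis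
    by (simp add: complex_eq_iff norm_eq_sqrt_cinner cinner_ge_zero)
qed

lemma ip_self: "ip x x = (norm x)\<^sup>2"
  by (simp add: ip_def cinner_self)

lemma ip_commute: "ip x y = ip y x"
  by (metis ip_def cinner_commute cnj.simps(1))

lemma ip_add_left: "ip (x + y) z = ip x z + ip y z"
  and ip_add_right: "ip x (y + z) = ip x y + ip x z"
  and ip_diff_left: "ip (x - y) z = ip x z - ip y z"
  and ip_diff_right: "ip x (y - z) = ip x y - ip x z"
  and ip_scaleR_left [simp]: "ip (r *\<^sub>R x) z = r * ip x z"
  and ip_scaleR_right [simp]: "ip x (r *\<^sub>R z) = r * ip x z"
  and ip_zero_right [simp]: "ip z 0 = 0"
  by (auto simp: ip_def cinner_algebra)

lemmas ip_algebra = ip_add_left ip_add_right ip_diff_left ip_diff_right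

lemma norm_add_sq: "(norm (x + y))\<^sup>2 = (norm x)\<^sup>2 + 2 * ip x y + (norm y)\<^sup>2"
  for x y :: "'a::complex_inner"
  using ip_commute[of x y] by (simp add: ip_algebra flip: ip_self)

lemma norm_diff_sq: "(norm (x - y))\<^sup>2 = (norm x)\<^sup>2 - 2 * ip x y + (norm y)\<^sup>2"
  for x y :: "'a::complex_inner"
  using ip_commute[of x y] by (simp add: ip_algebra flip: ip_self)

lemma norm_diff_scaleR_sq:
  "(norm (x - r *\<^sub>R y))\<^sup>2 = (norm x)\<^sup>2 - 2 * r * ip x y + r\<^sup>2 * (norm y)\<^sup>2"
  for x y :: "'a::complex_inner"
  by (simp add: norm_diff_sq power_mult_distrib)

lemma norm_scaleC: "norm (a *\<^sub>C x) = cmod a * norm x"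
proof -
  have "cinner (a *\<^sub>C x) (a *\<^sub>C x) = a * cnj a * cinner x x"
    by (simp only: cinner_scaleC_left cinner_scaleC_right mult_ac)
  also have "a * cnj a = of_real ((cmod a)\<^sup>2)"
    by (simp only: complex_norm_square)
  finally have "complex_of_real ((norm (a *\<^sub>C x))\<^sup>2) = of_real ((cmod a * norm x)\<^sup>2)"
    by (simp add: cinner_self power_mult_distrib)
  then have "(norm (a *\<^sub>C x))\<^sup>2 = (cmod a * norm x)\<^sup>2"
    unfolding of_real_eq_iff .
  then show ?thesis
    by (simp add: power2_eq_iff_nonneg)
qed

lemma ip_Cauchy_Schwarz: "\<bar>ip x y\<bar> \<le> norm x * norm y"
proof (cases "y = 0")
  case False
  define r where "r = ip x y / (norm y)\<^sup>2"
  have "0 \<le> (norm (x - r *\<^sub>R y))\<^sup>2" by simp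
  also have "\<dots> = (norm x)\<^sup>2 - (ip x y)\<^sup>2 / (norm y)\<^sup>2"
    using False unfolding norm_diff_scaleR_sq r_def by (simp add: field_simps power2_eq_square)
  finally have "(ip x y)\<^sup>2 \<le> (norm x * norm y)\<^sup>2"
    using False by (simp add: field_simps power_mult_distrib)
  then show ?thesis
    by (metis abs_le_square_iff abs_mult abs_norm_cancel)
qed simp

lemma cinner_Cauchy_Schwarz: "cmod (cinner x y) \<le> norm x * norm y"
proof (cases "cinner x y = 0")
  case False
  \<comment> \<open>Rotating \<^term>\<open>y\<close> by a phase makes the inner product real.\<close>
  define c where "c = cnj (cinner x y) / cmod (cinner x y)"
  have "cinner x (c *\<^sub>C y) = (cinner x y * cnj (cinner x y)) / cmod (cinner x y)"
    by (simp add: c_def cinner_scaleC_right)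
  also have "\<dots> = cmod (cinner x y)"
    using False by (simp only: complex_norm_square[symmetric]) (simp add: power2_eq_square)
  finally have "cinner x (c *\<^sub>C y) = cmod (cinner x y)" .
  moreover have "cmod c = 1"
    using False by (simp add: c_def norm_divide)
  ultimately show ?thesis
    using ip_Cauchy_Schwarz[of x "c *\<^sub>C y"] by (simp add: ip_def norm_scaleC)
qed simp

lemma bounded_linear_cinner: "bounded_linear (cinner y)"
  by (rule bounded_linear_intro[where K = "norm y"])
     (simp_all add: cinner_add_right scaleR_conv_of_real cinner_Cauchy_Schwarz mult.commute[of "norm _" "norm y"])

lemma bounded_linear_ip: "bounded_linear (ip y)"
  unfolding ip_def by (rule bounded_linear_compose[OF bounded_linear_Re bounded_linear_cinner])

lemma cinner_eq_zero_closure: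
  assumes "\<And>s. s \<in> S \<Longrightarrow> cinner s x = 0" "r \<in> closure S"
  shows "cinner r x = 0"
proof -
  have "closed {r. cinner x r = 0}"
    by (intro closed_Collect_eq continuous_intros linear_continuous_on bounded_linear_cinner)
  moreover have "S \<subseteq> {r. cinner x r = 0}"
    using assms(1) by (auto, metis cinner_commute complex_cnj_zero)
  ultimately have "cinner x r = 0"
    using closure_minimal assms(2) by blast
  then show ?thesis by (metis cinner_commute complex_cnj_zero)
qed

lemma closure_scaleR_diff:
  fixes S :: "'a::complex_inner set"
  assumes S: "\<And>u v r. u \<in> S \<Longrightarrow> v \<in> S \<Longrightarrow> u - r *\<^sub>R v \<in> S" and "u \<in> closure S" "v \<in> S"
  shows "u - r *\<^sub>R v \<in> closure S"
proof -
  obtain f where f: "\<And>n. f n \<in> S" "f \<longlonglongrightarrow> u" using assms(2) closure_sequential by blast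
  have "(\<lambda>n. f n - r *\<^sub>R v) \<longlonglongrightarrow> u - r *\<^sub>R v" by (intro tendsto_intros f)
  moreover have "\<And>n. f n - r *\<^sub>R v \<in> S" using S f(1) assms(3) by blast
  ultimately show ?thesis
    unfolding closure_sequential by (intro exI[of _ "\<lambda>n. f n - r *\<^sub>R v"]) blast
qed

text \<open>
  A minimizing sequence for the distance from \<open>x\<close> to \<open>S\<close> is Cauchy by the parallelogram law, and
  its limit is the foot of the perpendicular. This is the only place where completeness enters.
\<close>
lemma projection_on_closure:
  fixes S :: "'a::chilbert_space set"
  assumes S: "complex_vector.subspace S"
  obtains r where "r \<in> closure S" "\<And>s. s \<in> S \<Longrightarrow> cinner s (x - r) = 0"
proof -
  define \<delta> where "\<delta> = (INF s\<in>S. (norm (x - s))\<^sup>2)"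
  have ne: "S \<noteq> {}" using S complex_vector.subspace_0 by blast
  have bdd: "bdd_below ((\<lambda>s. (norm (x - s))\<^sup>2) ` S)" by (rule bdd_belowI[of _ 0]) auto
  have low: "\<delta> \<le> (norm (x - s))\<^sup>2" if "s \<in> S" for s
    unfolding \<delta>_def using bdd that by (rule cINF_lower)
  have "\<exists>s\<in>S. (norm (x - s))\<^sup>2 < \<delta> + 1 / Suc n" for n :: nat
    using cINF_less_iff[OF ne bdd, of "\<delta> + 1 / Suc n"] unfolding \<delta>_def by auto
  then obtain f where f: "\<And>n. f n \<in> S" "\<And>n. (norm (x - f n))\<^sup>2 < \<delta> + 1 / Suc n" by metis
  have scR: "r *\<^sub>R s \<in> S" if "s \<in> S" for r s
    using S that by (simp add: scaleR_scaleC complex_vector.subspace_scale)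
  \<comment> \<open>Parallelogram law, with the midpoint of \<open>f m\<close> and \<open>f n\<close> tested against the infimum.\<close>
  have plaw: "(norm (f m - f n))\<^sup>2 \<le> 2 / Suc m + 2 / Suc n" for m n
  proof -
    have "(1/2) *\<^sub>R (f m + f n) \<in> S"
      using S f(1) scR complex_vector.subspace_add by blast
    then have "\<delta> \<le> (norm (x - (1/2) *\<^sub>R (f m + f n)))\<^sup>2" by (rule low)
    also have "\<dots> = (1/4) * (norm ((x - f m) + (x - f n)))\<^sup>2"
    proof -
      have "x - (1/2) *\<^sub>R (f m + f n) = (1/2) *\<^sub>R ((x - f m) + (x - f n))"
        by (simp add: algebra_simps flip: scaleR_add_left)
      then show ?thesis by (simp add: power2_eq_square)
    qed
    finally have "4 * \<delta> \<le> (norm ((x - f m) + (x - f n)))\<^sup>2" by simp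
    moreover have "f m - f n = (x - f n) - (x - f m)" by simp
    then have "(norm (f m - f n))\<^sup>2 = 2 * (norm (x - f m))\<^sup>2 + 2 * (norm (x - f n))\<^sup>2
        - (norm ((x - f m) + (x - f n)))\<^sup>2"
      using norm_diff_sq[of "x - f n" "x - f m"] norm_add_sq[of "x - f m" "x - f n"]
        ip_commute[of "x - f n" "x - f m"] by simp
    ultimately show ?thesis using f(2)[of m] f(2)[of n] by simp
  qed
  have "Cauchy f"
  proof (rule metric_CauchyI)
    fix e :: real assume "0 < e"
    then obtain N :: nat where N: "4 / e\<^sup>2 < real N" using reals_Archimedean2 by blast
    then have "real N > 0" using \<open>0 < e\<close> by (smt (verit) divide_nonneg_nonneg zero_le_power2)
    have "dist (f m) (f n) < e" if "m \<ge> N" "n \<ge> N" for m n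
    proof -
      have "2 / Suc m \<le> 2 / real N" "2 / Suc n \<le> 2 / real N"
        using that \<open>real N > 0\<close> by (auto intro!: divide_left_mono)
      then have "(norm (f m - f n))\<^sup>2 \<le> 4 / real N" using plaw[of m n] by simp
      also have "\<dots> < e\<^sup>2" using N \<open>0 < e\<close> \<open>real N > 0\<close> by (simp add: field_simps)
      finally show ?thesis using \<open>0 < e\<close> by (simp add: dist_norm power_less_imp_less_base)
    qed
    then show "\<exists>M. \<forall>m\<ge>M. \<forall>n\<ge>M. dist (f m) (f n) < e" by blast
  qed
  then obtain r where r: "f \<longlonglongrightarrow> r" using Cauchy_convergent convergent_def by blast
  have r1: "r \<in> closure S" using r f(1) closure_sequential by blast
  have "(\<lambda>n. (norm (x - f n))\<^sup>2) \<longlonglongrightarrow> (norm (x - r))\<^sup>2" by (intro tendsto_intros r)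
  moreover have "(\<lambda>n. \<delta> + 1 / real (Suc n)) \<longlonglongrightarrow> \<delta> + 0"
    by (intro tendsto_intros LIMSEQ_Suc[OF lim_1_over_n])
  ultimately have min: "(norm (x - r))\<^sup>2 \<le> \<delta>"
    using f(2) by (intro LIMSEQ_le[of "\<lambda>n. (norm (x - f n))\<^sup>2" _ "\<lambda>n. \<delta> + 1 / real (Suc n)"]) (auto intro: less_imp_le)
  have low': "\<delta> \<le> (norm (x - r - s))\<^sup>2" if "s \<in> S" for s
  proof (rule LIMSEQ_le_const)
    show "(\<lambda>n. (norm (x - f n - s))\<^sup>2) \<longlonglongrightarrow> (norm (x - r - s))\<^sup>2" by (intro tendsto_intros r)
    have "\<delta> \<le> (norm (x - (f n + s)))\<^sup>2" for n
      using low S f(1) that complex_vector.subspace_add by blast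
    then show "\<exists>N. \<forall>n\<ge>N. \<delta> \<le> (norm (x - f n - s))\<^sup>2" by (simp add: diff_diff_eq)
  qed
  have re: "ip (x - r) s = 0" if "s \<in> S" for s
  proof (cases "s = 0")
    case False
    define k where "k = ip (x - r) s / (norm s)\<^sup>2"
    have "(norm (x - r))\<^sup>2 \<le> (norm (x - r - k *\<^sub>R s))\<^sup>2"
      using low'[OF scR[OF that]] min by (rule order.trans[rotated])
    also have "\<dots> = (norm (x - r))\<^sup>2 - (ip (x - r) s)\<^sup>2 / (norm s)\<^sup>2"
      using False unfolding norm_diff_scaleR_sq k_def by (simp add: field_simps power2_eq_square)
    finally show ?thesis using False by (simp add: divide_le_0_iff)
  qed simp
  have "cinner s (x - r) = 0" if "s \<in> S" for s
  proof -
    \<comment> \<open>The real part for \<open>\<i> s\<close> gives the imaginary part for \<open>s\<close>.\<close>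
    have "\<i> *\<^sub>C s \<in> S" using S that complex_vector.subspace_scale by blast
    then have "Re (cinner (x - r) s) = 0" "Re (\<i> * cinner (x - r) s) = 0"
      using re[OF that] re[of "\<i> *\<^sub>C s"] by (auto simp: ip_def cinner_scaleC_right)
    then have "cinner (x - r) s = 0" by (simp add: complex_eq_iff)
    then show ?thesis by (metis cinner_commute complex_cnj_zero)
  qed
  then show ?thesis using that r1 by blast
qed

section \<open>Spectral gaps of symmetric operators\<close>

definition symmetric_operator :: "'a::complex_inner set \<Rightarrow> ('a \<Rightarrow> 'a) \<Rightarrow> bool" where
  "symmetric_operator X T \<longleftrightarrow> linear_operator X T
     \<and> (\<forall>x\<in>X. \<forall>y\<in>X. cinner (T x) y = cinner x (T y))"

text \<open>
  The inequality is \<open>\<langle>(T - a) x, (T - b) x\<rangle> \<ge> 0\<close> multiplied out, so that it is visibly affine in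
  \<open>a\<close> and in \<open>b\<close>. For self-adjoint \<open>T\<close> it says that the open interval from \<open>a\<close> to \<open>b\<close> contains no
  spectrum.
\<close>
definition spectral_gap :: "'a::complex_inner set \<Rightarrow> ('a \<Rightarrow> 'a) \<Rightarrow> real \<Rightarrow> real \<Rightarrow> bool" where
  "spectral_gap X T a b \<longleftrightarrow>
     (\<forall>x\<in>X. (a + b) * ip (T x) x \<le> (norm (T x))\<^sup>2 + a * b * (norm x)\<^sup>2)"

lemma subspace_scaleR: "complex_vector.subspace X \<Longrightarrow> x \<in> X \<Longrightarrow> r *\<^sub>R x \<in> X"
  by (simp add: scaleR_scaleC complex_vector.subspace_scale)

lemma linear_operator_subspace: "linear_operator X T \<Longrightarrow> complex_vector.subspace X"
  by (simp add: linear_operator_def)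

lemma linear_operator_scaleC:
  "linear_operator X T \<Longrightarrow> x \<in> X \<Longrightarrow> T (c *\<^sub>C x) = c *\<^sub>C T x"
  by (simp add: linear_operator_def)

lemma linear_operator_scaleR:
  "linear_operator X T \<Longrightarrow> x \<in> X \<Longrightarrow> T (r *\<^sub>R x) = r *\<^sub>R T x"
  by (simp add: scaleR_scaleC linear_operator_scaleC)

lemma linear_operator_add:
  "linear_operator X T \<Longrightarrow> x \<in> X \<Longrightarrow> y \<in> X \<Longrightarrow> T (x + y) = T x + T y"
  by (simp add: linear_operator_def)

lemma linear_operator_diff:
  assumes "linear_operator X T" "x \<in> X" "y \<in> X"
  shows "T (x - y) = T x - T y"
proof -
  have "(-1) *\<^sub>C y \<in> X"
    using assms complex_vector.subspace_scale linear_operator_subspace by blast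
  then have "T (x + (-1) *\<^sub>C y) = T x + (-1) *\<^sub>C T y"
    using assms by (simp only: linear_operator_add linear_operator_scaleC)
  then show ?thesis by simp
qed

lemma linear_operator_zero: "linear_operator X T \<Longrightarrow> T 0 = 0"
  using linear_operator_diff[of X T 0 0] complex_vector.subspace_0 linear_operator_subspace
  by fastforce

lemma linear_operator_sum:
  assumes "linear_operator X T" "\<And>i. i \<in> I \<Longrightarrow> f i \<in> X"
  shows "T (\<Sum>i\<in>I. c i *\<^sub>C f i) = (\<Sum>i\<in>I. c i *\<^sub>C T (f i))"
  using assms(2)
proof (induction I rule: infinite_finite_induct)
  case (insert i I)
  have "c i *\<^sub>C f i \<in> X" "(\<Sum>i\<in>I. c i *\<^sub>C f i) \<in> X"
    using insert.prems assms(1) linear_operator_subspace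
    by (auto intro!: complex_vector.subspace_sum complex_vector.subspace_scale)
  then show ?case
    using insert linear_operator_add[OF assms(1)] linear_operator_scaleC[OF assms(1)] by simp
qed (simp_all add: linear_operator_zero[OF assms(1)])

lemma linear_operator_shift:
  assumes "linear_operator X T"
  shows "linear_operator X (\<lambda>x. T x - z *\<^sub>C x)"
  unfolding linear_operator_def
  using assms linear_operator_add[OF assms] linear_operator_scaleC[OF assms]
  by (auto simp: linear_operator_subspace complex_vector.scale_right_diff_distrib
      scaleC_add_right mult.commute scaleC_scaleC algebra_simps)

lemma linear_operator_mono:
  "linear_operator X T \<Longrightarrow> complex_vector.subspace Y \<Longrightarrow> Y \<subseteq> X \<Longrightarrow> linear_operator Y T"
  unfolding linear_operator_def by blast

lemma symmetric_operator_linear: "symmetric_operator X T \<Longrightarrow> linear_operator X T"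
  by (simp add: symmetric_operator_def)

lemma symmetric_operatorD:
  "symmetric_operator X T \<Longrightarrow> x \<in> X \<Longrightarrow> y \<in> X \<Longrightarrow> cinner (T x) y = cinner x (T y)"
  by (simp add: symmetric_operator_def)

lemma symmetric_operator_mono:
  "symmetric_operator X T \<Longrightarrow> complex_vector.subspace Y \<Longrightarrow> Y \<subseteq> X \<Longrightarrow> symmetric_operator Y T"
  unfolding symmetric_operator_def by (meson linear_operator_mono subsetD)

lemma spectral_gap_mono: "spectral_gap X T a b \<Longrightarrow> Y \<subseteq> X \<Longrightarrow> spectral_gap Y T a b"
  unfolding spectral_gap_def by blast

text \<open>
  With equal end points the gap form is \<open>\<parallel>(T - a) x\<parallel>\<^sup>2\<close>.
\<close>
lemma spectral_gap_trivial: "spectral_gap X T a a"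
  unfolding spectral_gap_def
proof
  fix x
  have "0 \<le> (norm (T x - a *\<^sub>R x))\<^sup>2" by simp
  then show "(a + a) * ip (T x) x \<le> (norm (T x))\<^sup>2 + a * a * (norm x)\<^sup>2"
    unfolding norm_diff_scaleR_sq by (simp add: power2_eq_square)
qed

lemma affine_nonneg_between:
  fixes p q :: real
  assumes "a \<le> c" "c \<le> b" "0 \<le> p + a * q" "0 \<le> p + b * q"
  shows "0 \<le> p + c * q"
proof (cases "0 \<le> q")
  case True
  then have "a * q \<le> c * q" using assms by (intro mult_right_mono) auto
  then show ?thesis using assms by linarith
next
  case False
  then have "b * q \<le> c * q" using assms by (intro mult_right_mono_neg) auto
  then show ?thesis using assms by linarith
qed

text \<open>
  For fixed \<open>x\<close> the gap form is affine in each end point and nonnegative on the diagonal, so it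
  stays nonnegative when one end point moves towards the other.
\<close>
lemma spectral_gap_shrink:
  assumes gap: "spectral_gap X T a b" and "a \<le> a'" "a' \<le> b'" "b' \<le> b"
  shows "spectral_gap X T a' b'"
  unfolding spectral_gap_def
proof
  fix x assume "x \<in> X"
  define A where "A = (norm (T x))\<^sup>2"
  define C where "C = ip (T x) x"
  define N where "N = (norm x)\<^sup>2"
  have diag: "0 \<le> A - (s + s) * C + s * s * N" for s
    using spectral_gap_trivial[of "{x}" T s] by (simp add: spectral_gap_def A_def C_def N_def)
  have ab: "0 \<le> A - (a + b) * C + a * b * N"
    using gap \<open>x \<in> X\<close> by (force simp: spectral_gap_def A_def C_def N_def)
  define f where "f u v = A - (u + v) * C + u * v * N" for u v
  have f_left: "f u v = (A - v * C) + u * (v * N - C)"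
    and f_right: "f u v = (A - u * C) + v * (u * N - C)" for u v
    by (simp_all add: f_def algebra_simps)
  have f_diag: "0 \<le> f s s" for s
    using diag[of s] by (simp add: f_def)
  have "0 \<le> f a b" using ab by (simp add: f_def)
  then have "0 \<le> f a b'"
    using affine_nonneg_between[of a b' b] f_diag[of a] assms by (metis f_right order.trans)
  then have "0 \<le> f a' b'"
    using affine_nonneg_between[of a a' b'] f_diag[of b'] assms by (metis f_left)
  then show "(a' + b') * ip (T x) x \<le> (norm (T x))\<^sup>2 + a' * b' * (norm x)\<^sup>2"
    by (simp add: f_def A_def C_def N_def)
qed

text \<open>
  The gap form for \<open>t - e\<close> and \<open>t + e\<close> is \<open>\<parallel>(T - t) x\<parallel>\<^sup>2 - e\<^sup>2 \<parallel>x\<parallel>\<^sup>2\<close>.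
\<close>
lemma spectral_gap_bounded_below:
  assumes "0 \<le> e"
    and "\<And>x. x \<in> X \<Longrightarrow> e * norm x \<le> norm (T x - complex_of_real t *\<^sub>C x)"
  shows "spectral_gap X T (t - e) (t + e)"
  unfolding spectral_gap_def
proof
  fix x assume "x \<in> X"
  then have "(e * norm x)\<^sup>2 \<le> (norm (T x - t *\<^sub>R x))\<^sup>2"
    using assms by (intro power_mono) (auto simp: scaleR_scaleC)
  then show "(t - e + (t + e)) * ip (T x) x \<le> (norm (T x))\<^sup>2 + (t - e) * (t + e) * (norm x)\<^sup>2"
    unfolding norm_diff_scaleR_sq by (simp add: power2_eq_square algebra_simps)
qed

lemma spectral_gap_no_eigenvector:
  assumes "spectral_gap X T a b" "a < s" "s < b" "x \<in> X" "T x = complex_of_real s *\<^sub>C x"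
  shows "x = 0"
proof -
  have T: "T x = s *\<^sub>R x" using assms by (simp add: scaleR_scaleC)
  have "(a + b) * (s * (norm x)\<^sup>2) \<le> s\<^sup>2 * (norm x)\<^sup>2 + a * b * (norm x)\<^sup>2"
    using assms(1,4) unfolding spectral_gap_def
    by (metis T ip_scaleR_left ip_self norm_scaleR power_mult_distrib power2_abs)
  then have "0 \<le> ((s - a) * (s - b)) * (norm x)\<^sup>2"
    by (simp add: algebra_simps power2_eq_square)
  moreover have "(s - a) * (s - b) < 0" using assms by (simp add: mult_pos_neg)
  ultimately have "(norm x)\<^sup>2 \<le> 0" by (metis mult_neg_pos not_le)
  then show ?thesis by simp
qed

text \<open>
  Let \<open>G = T - t\<close>, \<open>l = t - a\<close>, \<open>r = c - t\<close>. The two gaps say \<open>\<parallel>G x\<parallel>\<^sup>2 \<ge> - l \<langle>G x, x\<rangle>\<close> and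
  \<open>\<parallel>G x\<parallel>\<^sup>2 \<ge> r \<langle>G x, x\<rangle>\<close>, that is, the form of the inverse of \<open>G\<close>, defined on the range of \<open>G\<close>,
  lies between \<open>- 1 / l\<close> and \<open>1 / r\<close>. After subtracting the midpoint \<open>\<kappa>\<close> of this interval the form is
  bounded by its half length \<open>\<rho>\<close>; by symmetry, polarization and density of the range this bounds
  the norm: \<open>\<parallel>x - \<kappa> G x\<parallel> \<le> \<rho> \<parallel>G x\<parallel>\<close>. Squared and multiplied by \<open>l r\<close>, this is the gap from \<open>a\<close> to
  \<open>c\<close>.
\<close>
lemma spectral_gap_merge:
  assumes sym: "symmetric_operator X T"
    and dense: "X \<subseteq> closure ((\<lambda>x. T x - complex_of_real t *\<^sub>C x) ` X)"
    and gaps: "spectral_gap X T a t" "spectral_gap X T t c"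
    and "a \<le> t" "t \<le> c"
  shows "spectral_gap X T a c"
proof (cases "a = t \<or> t = c")
  case False
  define l where "l = t - a"
  define r where "r = c - t"
  have "0 < l" "0 < r" using assms(5,6) False by (auto simp: l_def r_def)
  define \<kappa> where "\<kappa> = (1 / r - 1 / l) / 2"
  define \<rho> where "\<rho> = (1 / r + 1 / l) / 2"
  have "0 < \<rho>" using \<open>0 < l\<close> \<open>0 < r\<close> by (simp add: \<rho>_def add_pos_pos)
  define G where "G x = T x - t *\<^sub>R x" for x
  define w where "w x = x - \<kappa> *\<^sub>R G x" for x
  have lin: "linear_operator X T" using sym by (rule symmetric_operator_linear)
  note X = linear_operator_subspace[OF lin]
  have G_add: "G (x + y) = G x + G y" "w (x + y) = w x + w y"
    and G_diff: "G (x - y) = G x - G y" "w (x - y) = w x - w y" if "x \<in> X" "y \<in> X" for x y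
    by (simp_all add: G_def w_def linear_operator_add[OF lin that] linear_operator_diff[OF lin that]
        algebra_simps)
  have G_sym: "ip (G x) y = ip x (G y)" if "x \<in> X" "y \<in> X" for x y
    using symmetric_operatorD[OF sym that] by (simp add: G_def ip_def cinner_algebra)
  have G_sq: "(norm (G x))\<^sup>2 = (norm (T x))\<^sup>2 - 2 * t * ip (T x) x + t\<^sup>2 * (norm x)\<^sup>2"
    and G_ip: "ip (G x) x = ip (T x) x - t * (norm x)\<^sup>2" for x
    unfolding G_def norm_diff_scaleR_sq by (simp_all add: ip_diff_left ip_self)
  have diag: "\<bar>ip (w x) (G x)\<bar> \<le> \<rho> * (norm (G x))\<^sup>2" if "x \<in> X" for x
  proof -
    have "(a + t) * ip (T x) x \<le> (norm (T x))\<^sup>2 + a * t * (norm x)\<^sup>2"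
      "(t + c) * ip (T x) x \<le> (norm (T x))\<^sup>2 + t * c * (norm x)\<^sup>2"
      using gaps that unfolding spectral_gap_def by blast+
    then have "- l * ip (G x) x \<le> (norm (G x))\<^sup>2" "r * ip (G x) x \<le> (norm (G x))\<^sup>2"
      unfolding G_sq G_ip l_def r_def by (simp_all add: algebra_simps power2_eq_square)
    then have "- ip (G x) x \<le> (1 / l) * (norm (G x))\<^sup>2" "ip (G x) x \<le> (1 / r) * (norm (G x))\<^sup>2"
      using \<open>0 < l\<close> \<open>0 < r\<close> by (simp_all add: field_simps)
    moreover have "ip (w x) (G x) = ip (G x) x - \<kappa> * (norm (G x))\<^sup>2"
      by (simp add: w_def ip_diff_left ip_self ip_commute[of x "G x"])
    ultimately show ?thesis
      unfolding \<kappa>_def \<rho>_def abs_le_iff by (simp add: field_simps)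
  qed
  have polar: "ip (w x) (G y) \<le> \<rho> / 2 * ((norm (G x))\<^sup>2 + (norm (G y))\<^sup>2)"
    if "x \<in> X" "y \<in> X" for x y
  proof -
    have xy: "x + y \<in> X" "x - y \<in> X"
      using X that complex_vector.subspace_add complex_vector.subspace_diff by blast+
    have "ip (w y) (G x) = ip (w x) (G y)"
      using G_sym[OF that] ip_commute[of "G x" y] ip_commute[of "G x" "G y"]
      by (simp add: w_def ip_diff_left)
    then have "4 * ip (w x) (G y) = ip (w (x + y)) (G (x + y)) - ip (w (x - y)) (G (x - y))"
      using that by (simp add: G_add G_diff ip_algebra)
    also have "\<dots> \<le> \<rho> * ((norm (G (x + y)))\<^sup>2 + (norm (G (x - y)))\<^sup>2)"
      using diag[OF xy(1)] diag[OF xy(2)] by (simp add: algebra_simps)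
    also have "(norm (G (x + y)))\<^sup>2 + (norm (G (x - y)))\<^sup>2 = 2 * ((norm (G x))\<^sup>2 + (norm (G y))\<^sup>2)"
      using that by (simp add: G_add G_diff norm_add_sq norm_diff_sq)
    finally show ?thesis by (simp add: algebra_simps)
  qed
  have G_img: "(\<lambda>x. T x - complex_of_real t *\<^sub>C x) ` X = G ` X"
    by (simp add: G_def scaleR_scaleC)
  show ?thesis
    unfolding spectral_gap_def
  proof
    fix x assume x: "x \<in> X"
    have "closed {z. ip (w x) z \<le> \<rho> / 2 * ((norm (G x))\<^sup>2 + (norm z)\<^sup>2)}"
      by (intro closed_Collect_le continuous_intros linear_continuous_on bounded_linear_ip)
    then have polar': "ip (w x) z \<le> \<rho> / 2 * ((norm (G x))\<^sup>2 + (norm z)\<^sup>2)"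
      if "z \<in> closure (G ` X)" for z
      using closure_minimal[of "G ` X" "{z. ip (w x) z \<le> \<rho> / 2 * ((norm (G x))\<^sup>2 + (norm z)\<^sup>2)}"]
        polar[OF x] that by blast
    \<comment> \<open>The bound is applied to the multiple \<open>w x / \<rho>\<close>, for which it is sharpest.\<close>
    have "(1 / \<rho>) *\<^sub>R x - (\<kappa> / \<rho>) *\<^sub>R G x \<in> closure (G ` X)"
    proof (rule closure_scaleR_diff)
      fix u v s assume "u \<in> G ` X" "v \<in> G ` X"
      then obtain y z where yz: "y \<in> X" "z \<in> X" "u = G y" "v = G z" by blast
      have "s *\<^sub>R z \<in> X" using X yz by (simp add: subspace_scaleR)
      moreover have "G (s *\<^sub>R z) = s *\<^sub>R v"
        unfolding yz(4) G_def linear_operator_scaleR[OF lin yz(2)]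
        by (simp add: scaleR_diff_right mult.commute)
      ultimately show "u - s *\<^sub>R v \<in> G ` X"
        using yz G_diff(1)[of y "s *\<^sub>R z"] complex_vector.subspace_diff[OF X]
        by (metis imageI)
    qed (use x X dense G_img subspace_scaleR in \<open>auto simp: G_img\<close>)
    then have "ip (w x) ((1 / \<rho>) *\<^sub>R w x) \<le> \<rho> / 2 * ((norm (G x))\<^sup>2 + (norm ((1 / \<rho>) *\<^sub>R w x))\<^sup>2)"
      by (intro polar') (simp add: w_def algebra_simps)
    then have "(norm (w x))\<^sup>2 \<le> \<rho>\<^sup>2 * (norm (G x))\<^sup>2"
      using \<open>0 < \<rho>\<close> by (simp add: ip_self power_mult_distrib field_simps power2_eq_square)
    moreover have "(norm (w x))\<^sup>2 = (norm x)\<^sup>2 - 2 * \<kappa> * ip (G x) x + \<kappa>\<^sup>2 * (norm (G x))\<^sup>2"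
      unfolding w_def norm_diff_scaleR_sq by (simp add: ip_commute[of x "G x"])
    ultimately have "(norm x)\<^sup>2 - 2 * \<kappa> * ip (G x) x \<le> (\<rho>\<^sup>2 - \<kappa>\<^sup>2) * (norm (G x))\<^sup>2"
      by (simp add: algebra_simps)
    then have "l * r * ((norm x)\<^sup>2 - 2 * \<kappa> * ip (G x) x) \<le> l * r * ((\<rho>\<^sup>2 - \<kappa>\<^sup>2) * (norm (G x))\<^sup>2)"
      using \<open>0 < l\<close> \<open>0 < r\<close> by (intro mult_left_mono) auto
    moreover have "l * r * (\<rho>\<^sup>2 - \<kappa>\<^sup>2) = 1" "2 * (l * r * \<kappa>) = l - r"
      using \<open>0 < l\<close> \<open>0 < r\<close> by (simp_all add: \<rho>_def \<kappa>_def field_simps power2_eq_square)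
    moreover have "l * r * ((norm x)\<^sup>2 - 2 * \<kappa> * ip (G x) x)
        = l * r * (norm x)\<^sup>2 - 2 * (l * r * \<kappa>) * ip (G x) x"
      "l * r * ((\<rho>\<^sup>2 - \<kappa>\<^sup>2) * (norm (G x))\<^sup>2) = (l * r * (\<rho>\<^sup>2 - \<kappa>\<^sup>2)) * (norm (G x))\<^sup>2"
      by (simp_all add: algebra_simps)
    ultimately have "l * r * (norm x)\<^sup>2 - (l - r) * ip (G x) x \<le> (norm (G x))\<^sup>2"
      by simp
    then show "(a + c) * ip (T x) x \<le> (norm (T x))\<^sup>2 + a * c * (norm x)\<^sup>2"
      unfolding G_sq G_ip l_def r_def by (simp add: algebra_simps power2_eq_square)
  qed
qed (use gaps in auto)

text \<open>
  Bisection of \<open>[a, b]\<close>: small intervals lie in a local gap, and adjacent gaps merge.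
\<close>
lemma spectral_gap_from_local:
  assumes sym: "symmetric_operator X T" and "a \<le> b"
    and dense: "\<And>t. a \<le> t \<Longrightarrow> t \<le> b \<Longrightarrow> X \<subseteq> closure ((\<lambda>x. T x - complex_of_real t *\<^sub>C x) ` X)"
    and local_gap: "\<And>t. a \<le> t \<Longrightarrow> t \<le> b \<Longrightarrow> \<exists>e>0. spectral_gap X T (t - e) (t + e)"
  shows "spectral_gap X T a b"
proof -
  define P where "P u v \<longleftrightarrow> (a \<le> u \<longrightarrow> v \<le> b \<longrightarrow> spectral_gap X T u v)" for u v
  have "P a b"
  proof (rule Bolzano[OF \<open>a \<le> b\<close>])
    fix u v w assume "P u v" "P v w" "u \<le> v" "v \<le> w"
    then show "P u w"
      unfolding P_def using spectral_gap_merge[OF sym dense[of v], of u w] by auto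
  next
    fix t assume t: "a \<le> t" "t \<le> b"
    then obtain e where e: "e > 0" "spectral_gap X T (t - e) (t + e)" using local_gap by blast
    then have "spectral_gap X T u v" if "u \<le> t" "t \<le> v" "v - u < e" for u v
      using that by (intro spectral_gap_shrink[OF e(2)]) auto
    then show "\<exists>e>0. \<forall>u v. u \<le> t \<and> t \<le> v \<and> v - u < e \<longrightarrow> P u v"
      unfolding P_def using e(1) by blast
  qed
  then show ?thesis by (simp add: P_def)
qed

section \<open>Orthonormal bases and the finite dimensional spectral theorem\<close>

definition orthonormal :: "'a::complex_inner set \<Rightarrow> bool" where
  "orthonormal B \<longleftrightarrow> (\<forall>x\<in>B. \<forall>y\<in>B. cinner x y = (if x = y then 1 else 0))"

text \<open>
  The orthogonal projection onto the span of a finite orthonormal set.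
\<close>
definition expansion :: "'a::complex_inner set \<Rightarrow> 'a \<Rightarrow> 'a" where
  "expansion B x = (\<Sum>b\<in>B. cinner b x *\<^sub>C b)"

lemma orthonormal_cinner_sum:
  assumes "finite B" "orthonormal B" "b \<in> B"
  shows "cinner b (\<Sum>x\<in>B. c x *\<^sub>C x) = c b"
proof -
  have "cinner b (\<Sum>x\<in>B. c x *\<^sub>C x) = (\<Sum>x\<in>B. c x * cinner b x)"
    by (simp add: cinner_sum_right cinner_scaleC_right)
  also have "\<dots> = (\<Sum>x\<in>B. if x = b then c x else 0)"
    using assms by (intro sum.cong) (auto simp: orthonormal_def)
  finally show ?thesis using assms by simp
qed

lemma orthonormal_cinner_sums:
  assumes "finite B" "orthonormal B"
  shows "cinner (\<Sum>b\<in>B. c b *\<^sub>C b) (\<Sum>b\<in>B. e b *\<^sub>C b) = (\<Sum>b\<in>B. cnj (c b) * e b)"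
  by (simp add: cinner_sum_left cinner_scaleC_left orthonormal_cinner_sum[OF assms])

lemma orthonormal_independent:
  assumes "finite B" "orthonormal B"
  shows "complex_vector.independent B"
  using orthonormal_cinner_sum[OF assms] unfolding complex_vector.dependent_finite[OF assms(1)]
  by (metis cinner_zero_right)

lemma expansion_in_span: "expansion B x \<in> complex_vector.span B"
  unfolding expansion_def
  by (intro complex_vector.span_sum complex_vector.span_scale complex_vector.span_base)

lemma cinner_span_eq_zero:
  assumes "\<And>b. b \<in> B \<Longrightarrow> cinner b x = 0" "s \<in> complex_vector.span B"
  shows "cinner s x = 0"
  using assms(2) by (induction rule: complex_vector.span_induct_alt)
    (auto simp: cinner_add_left cinner_scaleC_left assms(1))

lemma expansion_residual:
  assumes "finite B" "orthonormal B" "s \<in> complex_vector.span B"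
  shows "cinner s (x - expansion B x) = 0"
  by (rule cinner_span_eq_zero[OF _ assms(3)])
    (simp add: cinner_diff_right expansion_def orthonormal_cinner_sum[OF assms(1,2)])

lemma expansion_unique:
  assumes "finite B" "orthonormal B" "v \<in> complex_vector.span B"
    and "\<And>s. s \<in> complex_vector.span B \<Longrightarrow> cinner s (x - v) = 0"
  shows "v = expansion B x"
proof -
  let ?u = "v - expansion B x"
  have u: "?u \<in> complex_vector.span B"
    using assms(3) expansion_in_span by (rule complex_vector.span_diff)
  have "cinner ?u ?u = cinner ?u (x - expansion B x) - cinner ?u (x - v)"
    by (simp add: cinner_diff_right)
  also have "\<dots> = 0" using assms(4)[OF u] expansion_residual[OF assms(1,2) u] by simp
  finally show ?thesis by (simp add: cinner_eq_zero_iff)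
qed

lemma expansion_id:
  assumes "finite B" "orthonormal B" "x \<in> complex_vector.span B"
  shows "expansion B x = x"
  using expansion_unique[OF assms, of x] by simp

lemma expansion_linear: "linear_operator UNIV (expansion B)"
  by (auto simp: linear_operator_def expansion_def cinner_add_right cinner_scaleC_right
      scaleC_add_left sum.distrib complex_vector.scale_sum_right scaleC_scaleC)

text \<open>
  An orthonormal subset of maximal size spans: a vector outside its span would, after removing
  its projection and normalizing, enlarge it.
\<close>
lemma orthonormal_basis_exists:
  assumes S: "complex_vector.subspace S" and fd: "finite_dimensional S"
  obtains B where "finite B" "orthonormal B" "B \<subseteq> S" "complex_vector.span B = S"
proof -
  obtain C where C: "finite C" "S \<subseteq> complex_vector.span C"
    using fd by (auto simp: finite_dimensional_def)
  define K where "K = {n. \<exists>B. finite B \<and> orthonormal B \<and> B \<subseteq> S \<and> card B = n}"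
  have "n \<le> card C" if "n \<in> K" for n
    using that C complex_vector.independent_span_bound[OF C(1)] orthonormal_independent
    unfolding K_def by (smt (verit) mem_Collect_eq order.trans)
  then have "finite K" by (meson finite_nat_set_iff_bounded_le)
  moreover have "0 \<in> K" unfolding K_def by (auto simp: orthonormal_def intro!: exI[of _ "{}"])
  ultimately have "Max K \<in> K" by (intro Max_in) auto
  then obtain B where B: "finite B" "orthonormal B" "B \<subseteq> S" "card B = Max K"
    unfolding K_def by blast
  have BS: "complex_vector.span B \<subseteq> S"
    using complex_vector.span_minimal[OF B(3) S] .
  have "x \<in> complex_vector.span B" if "x \<in> S" for x
  proof (rule ccontr)
    assume x: "x \<notin> complex_vector.span B"
    define y where "y = x - expansion B x"
    have "y \<noteq> 0" using x expansion_in_span[of B x] by (auto simp: y_def)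
    define z where "z = (1 / norm y) *\<^sub>R y"
    have orth: "cinner b z = 0" "cinner z b = 0" if "b \<in> B" for b
    proof -
      show "cinner b z = 0"
        using expansion_residual[OF B(1,2) complex_vector.span_base[OF that]]
        by (simp add: z_def y_def)
      then show "cinner z b = 0" by (metis cinner_commute complex_cnj_zero)
    qed
    have one: "cinner z z = 1" using \<open>y \<noteq> 0\<close> by (simp add: z_def cinner_self)
    have "z \<notin> B" using orth one by fastforce
    have "y \<in> S" unfolding y_def
      using S that BS expansion_in_span complex_vector.subspace_diff by blast
    then have "z \<in> S" using S by (simp add: z_def subspace_scaleR)
    have "orthonormal (insert z B)"
      using B(2) orth one \<open>z \<notin> B\<close> by (auto simp: orthonormal_def)
    then have "card (insert z B) \<in> K"
      unfolding K_def using B \<open>z \<in> S\<close> by blast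
    then show False
      using Max_ge[OF \<open>finite K\<close>] B \<open>z \<notin> B\<close> by fastforce
  qed
  then show ?thesis using that B BS by blast
qed

lemma finite_dimensional_mono: "finite_dimensional S \<Longrightarrow> T \<subseteq> S \<Longrightarrow> finite_dimensional T"
  unfolding finite_dimensional_def by blast

lemma linear_image_subspace:
  assumes "linear_operator X T"
  shows "complex_vector.subspace (T ` X)"
  unfolding complex_vector.subspace_def
proof (intro conjI ballI allI)
  note X = linear_operator_subspace[OF assms]
  show "0 \<in> T ` X"
    using linear_operator_zero[OF assms] complex_vector.subspace_0[OF X] by (metis imageI)
  fix u assume "u \<in> T ` X"
  then obtain x where x: "x \<in> X" "u = T x" by blast
  show "c *\<^sub>C u \<in> T ` X" for c
    using x complex_vector.subspace_scale[OF X] linear_operator_scaleC[OF assms] by (metis imageI)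
  fix v assume "v \<in> T ` X"
  then obtain y where "y \<in> X" "v = T y" by blast
  then show "u + v \<in> T ` X"
    using x complex_vector.subspace_add[OF X] linear_operator_add[OF assms] by (metis imageI)
qed

lemma linear_expansion:
  assumes "linear_operator (complex_vector.span B) T" "finite B" "orthonormal B"
    "x \<in> complex_vector.span B"
  shows "T x = (\<Sum>b\<in>B. cinner b x *\<^sub>C T b)"
  using linear_operator_sum[OF assms(1), of B "\<lambda>b. b" "\<lambda>b. cinner b x"] expansion_id[OF assms(2-4)]
  by (simp add: expansion_def complex_vector.span_base)

lemma norm_coefficient_sum_le:
  assumes "finite B" "orthonormal B"
  shows "norm (\<Sum>b\<in>B. cinner b x *\<^sub>C g b) \<le> (\<Sum>b\<in>B. norm (g b)) * norm x"
proof -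
  have "cmod (cinner b x) * norm (g b) \<le> norm (g b) * norm x" if "b \<in> B" for b
  proof -
    have "complex_of_real ((norm b)\<^sup>2) = of_real 1"
      using assms that cinner_self[of b] by (simp add: orthonormal_def)
    then have "norm b = 1" unfolding of_real_eq_iff by (simp add: power2_eq_1_iff) (smt (verit) norm_ge_zero)
    then have "cmod (cinner b x) \<le> norm x" using cinner_Cauchy_Schwarz[of b x] by simp
    then show ?thesis by (subst mult.commute) (rule mult_left_mono, auto)
  qed
  then show ?thesis
    unfolding sum_distrib_right by (intro order.trans[OF norm_sum] sum_mono) (simp add: norm_scaleC)
qed

lemma finite_dimensional_bounded:
  assumes "linear_operator X T" "finite_dimensional X"
  obtains C where "0 \<le> C" "\<And>x. x \<in> X \<Longrightarrow> norm (T x) \<le> C * norm x"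
proof -
  obtain B where B: "finite B" "orthonormal B" "B \<subseteq> X" "complex_vector.span B = X"
    using orthonormal_basis_exists linear_operator_subspace assms by metis
  show ?thesis
  proof (rule that)
    show "0 \<le> (\<Sum>b\<in>B. norm (T b))" by (simp add: sum_nonneg)
    show "norm (T x) \<le> (\<Sum>b\<in>B. norm (T b)) * norm x" if "x \<in> X" for x
      using linear_expansion[of B T x] norm_coefficient_sum_le[OF B(1,2), of x T] B assms(1) that
      by simp
  qed
qed

text \<open>
  A vector \<open>z\<close> of \<open>X\<close> orthogonal to the range satisfies \<open>\<parallel>T z\<parallel>\<^sup>2 = \<langle>T (T z), z\<rangle> = 0\<close>.
\<close>
lemma symmetric_injective_surjective:
  assumes sym: "symmetric_operator X T" and fd: "finite_dimensional X" and inv: "T ` X \<subseteq> X"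
    and inj: "\<And>x. x \<in> X \<Longrightarrow> T x = 0 \<Longrightarrow> x = 0"
  shows "T ` X = X"
proof (intro subset_antisym inv subsetI)
  fix y assume y: "y \<in> X"
  note lin = symmetric_operator_linear[OF sym]
  note X = linear_operator_subspace[OF lin]
  obtain B where B: "finite B" "orthonormal B" "B \<subseteq> T ` X" "complex_vector.span B = T ` X"
    using orthonormal_basis_exists[OF linear_image_subspace[OF lin]] fd inv finite_dimensional_mono
    by metis
  define z where "z = y - expansion B y"
  have "expansion B y \<in> T ` X" using expansion_in_span B(4) by blast
  then have z: "z \<in> X" using y inv X complex_vector.subspace_diff unfolding z_def by blast
  have "T (T z) \<in> T ` X" using z inv by blast
  then have "cinner (T (T z)) z = 0"
    using expansion_residual[OF B(1,2)] B(4) unfolding z_def by blast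
  then have "cinner (T z) (T z) = 0"
    using symmetric_operatorD[OF sym, of "T z" z] z inv by auto
  then have "z = 0" using inj[OF z] cinner_eq_zero_iff by blast
  then show "y \<in> T ` X" using \<open>expansion B y \<in> T ` X\<close> by (simp add: z_def)
qed

lemma injective_bounded_below:
  assumes lin: "linear_operator X T" and fd: "finite_dimensional X" and surj: "T ` X = X"
    and inj: "\<And>x. x \<in> X \<Longrightarrow> T x = 0 \<Longrightarrow> x = 0"
  obtains e where "0 < e" "\<And>x. x \<in> X \<Longrightarrow> e * norm x \<le> norm (T x)"
proof -
  note X = linear_operator_subspace[OF lin]
  obtain B where B: "finite B" "orthonormal B" "B \<subseteq> X" "complex_vector.span B = X"
    using orthonormal_basis_exists X fd by metis
  have "\<forall>b\<in>B. \<exists>x\<in>X. T x = b" using B(3) surj by (metis imageE subsetD)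
  then obtain g where g: "\<And>b. b \<in> B \<Longrightarrow> g b \<in> X" "\<And>b. b \<in> B \<Longrightarrow> T (g b) = b" by metis
  define C where "C = (\<Sum>b\<in>B. norm (g b))"
  have "0 \<le> C" by (simp add: C_def sum_nonneg)
  have "norm x \<le> C * norm (T x)" if "x \<in> X" for x
  proof -
    define y where "y = (\<Sum>b\<in>B. cinner b (T x) *\<^sub>C g b)"
    have y: "y \<in> X" unfolding y_def
      using X g by (intro complex_vector.subspace_sum complex_vector.subspace_scale) auto
    have "T y = (\<Sum>b\<in>B. cinner b (T x) *\<^sub>C T (g b))"
      unfolding y_def using g(1) by (rule linear_operator_sum[OF lin])
    also have "\<dots> = expansion B (T x)" unfolding expansion_def by (intro sum.cong) (auto simp: g)
    also have "\<dots> = T x" using expansion_id[OF B(1,2)] B(4) surj that by blast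
    finally have "T (x - y) = 0" using linear_operator_diff[OF lin that y] by simp
    then have "x = y" using inj X that y complex_vector.subspace_diff by (metis eq_iff_diff_eq_0)
    then show ?thesis using norm_coefficient_sum_le[OF B(1,2), of "T x" g] by (simp add: y_def C_def)
  qed
  then have "1 / (C + 1) * norm x \<le> norm (T x)" if "x \<in> X" for x
    using that \<open>0 \<le> C\<close> by (simp add: field_simps) (smt (verit) mult_right_mono norm_ge_zero)
  then show ?thesis using that[of "1 / (C + 1)"] \<open>0 \<le> C\<close> by simp
qed

lemma symmetric_operator_shift:
  assumes "symmetric_operator X T"
  shows "symmetric_operator X (\<lambda>x. T x - complex_of_real t *\<^sub>C x)"
  using assms linear_operator_shift[of X T] unfolding symmetric_operator_def
  by (simp add: cinner_algebra)

text \<open>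
  Without an eigenvector every \<open>T - t\<close> is bijective and bounded below on \<open>X\<close>. The local gaps then
  glue to a gap from \<open>- (C + 1)\<close> to \<open>C + 1\<close>, where \<open>C\<close> bounds the norm of \<open>T\<close>; but this gap says
  \<open>\<parallel>T x\<parallel> \<ge> (C + 1) \<parallel>x\<parallel>\<close>.
\<close>
lemma symmetric_has_eigenvector:
  assumes sym: "symmetric_operator X T" and fd: "finite_dimensional X" and inv: "T ` X \<subseteq> X"
    and "X \<noteq> {0}"
  obtains t :: real and x where "x \<in> X" "x \<noteq> 0" "T x = complex_of_real t *\<^sub>C x"
proof (rule ccontr)
  assume "\<not> thesis"
  with that have none: "\<And>t x. x \<in> X \<Longrightarrow> T x = complex_of_real t *\<^sub>C x \<Longrightarrow> x = 0" by blast
  note lin = symmetric_operator_linear[OF sym]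
  note X = linear_operator_subspace[OF lin]
  obtain C where C: "0 \<le> C" "\<And>x. x \<in> X \<Longrightarrow> norm (T x) \<le> C * norm x"
    using finite_dimensional_bounded[OF lin fd] by blast
  have inj: "x = 0" if "x \<in> X" "T x - complex_of_real t *\<^sub>C x = 0" for t x
    using none that by simp
  have inv': "(\<lambda>x. T x - complex_of_real t *\<^sub>C x) ` X \<subseteq> X" for t
    using inv X by (auto intro!: complex_vector.subspace_diff complex_vector.subspace_scale)
  have surj: "(\<lambda>x. T x - complex_of_real t *\<^sub>C x) ` X = X" for t
    using symmetric_injective_surjective[OF symmetric_operator_shift[OF sym] fd inv' inj] .
  have "spectral_gap X T (- (C + 1)) (C + 1)"
  proof (rule spectral_gap_from_local[OF sym])
    fix t :: real
    show "X \<subseteq> closure ((\<lambda>x. T x - complex_of_real t *\<^sub>C x) ` X)"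
      unfolding surj by (rule closure_subset)
    obtain e where "0 < e" "\<And>x. x \<in> X \<Longrightarrow> e * norm x \<le> norm (T x - complex_of_real t *\<^sub>C x)"
      using injective_bounded_below[OF linear_operator_shift[OF lin] fd surj[of t] inj[of _ t]]
      by blast
    then show "\<exists>e>0. spectral_gap X T (t - e) (t + e)"
      by (meson spectral_gap_bounded_below less_imp_le)
  qed (use C in auto)
  moreover obtain x where x: "x \<in> X" "x \<noteq> 0"
    using \<open>X \<noteq> {0}\<close> complex_vector.subspace_0[OF X] by blast
  ultimately have "((C + 1) * norm x)\<^sup>2 \<le> (norm (T x))\<^sup>2"
    by (force simp: spectral_gap_def power_mult_distrib power2_eq_square algebra_simps)
  then have "(C + 1) * norm x \<le> norm (T x)" by (rule power2_le_imp_le) simp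
  also have "\<dots> \<le> C * norm x" using C x by blast
  finally show False using x by (simp add: algebra_simps)
qed

lemma eigenspace_subspace:
  assumes "linear_operator X T"
  shows "complex_vector.subspace (eigenspace X T z)"
  unfolding complex_vector.subspace_def eigenspace_def
  using linear_operator_subspace[OF assms] assms
  by (auto simp: linear_operator_zero linear_operator_add linear_operator_scaleC
      complex_vector.subspace_0 complex_vector.subspace_add complex_vector.subspace_scale
      scaleC_add_right scaleC_scaleC mult.commute)

lemma eigenvectors_orthogonal:
  assumes sym: "symmetric_operator X T" and "s \<noteq> t"
    and "x \<in> eigenspace X T (complex_of_real s)" "y \<in> eigenspace X T (complex_of_real t)"
  shows "cinner x y = 0"
proof -
  have "of_real s * cinner x y = of_real t * cinner x y"
    using symmetric_operatorD[OF sym, of x y] assms(3,4)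
    by (simp add: eigenspace_def cinner_scaleC_left cinner_scaleC_right)
  then show ?thesis using \<open>s \<noteq> t\<close> by simp
qed

lemma eigenbasis_exists:
  assumes sym: "symmetric_operator X T" and "finite S"
    and fd: "\<And>s. s \<in> S \<Longrightarrow> finite_dimensional (eigenspace X T (complex_of_real s))"
  obtains B where "finite B" "orthonormal B" "B \<subseteq> X"
    "\<And>b. b \<in> B \<Longrightarrow> \<exists>s\<in>S. T b = complex_of_real s *\<^sub>C b"
    "\<And>s. s \<in> S \<Longrightarrow> eigenspace X T (complex_of_real s) \<subseteq> complex_vector.span B"
    "card B = (\<Sum>s\<in>S. multiplicity_of X T s)"
proof -
  note lin = symmetric_operator_linear[OF sym]
  have "\<exists>B. finite B \<and> orthonormal B \<and> B \<subseteq> eigenspace X T (complex_of_real s) \<and>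
    complex_vector.span B = eigenspace X T (complex_of_real s)" if "s \<in> S" for s
    using orthonormal_basis_exists[OF eigenspace_subspace[OF lin] fd[OF that]] by metis
  then obtain b where b: "\<And>s. s \<in> S \<Longrightarrow> finite (b s)" "\<And>s. s \<in> S \<Longrightarrow> orthonormal (b s)"
    "\<And>s. s \<in> S \<Longrightarrow> b s \<subseteq> eigenspace X T (complex_of_real s)"
    "\<And>s. s \<in> S \<Longrightarrow> complex_vector.span (b s) = eigenspace X T (complex_of_real s)" by metis
  define B where "B = (\<Union>s\<in>S. b s)"
  have orth: "cinner x y = 0" if "s \<in> S" "t \<in> S" "s \<noteq> t" "x \<in> b s" "y \<in> b t" for s t x y
    using eigenvectors_orthogonal[OF sym that(3)] b(3) that by blast
  have disj: "b s \<inter> b t = {}" if "s \<in> S" "t \<in> S" "s \<noteq> t" for s t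
  proof (rule ccontr)
    assume "b s \<inter> b t \<noteq> {}"
    then obtain x where "x \<in> b s" "x \<in> b t" by blast
    then have "cinner x x = 0" "cinner x x = 1"
      using orth[OF that, of x x] b(2)[OF that(1)] unfolding orthonormal_def by auto
    then show False by simp
  qed
  show ?thesis
  proof (rule that)
    show "finite B" using b(1) \<open>finite S\<close> by (auto simp: B_def)
    show "orthonormal B"
      unfolding orthonormal_def
    proof (intro ballI)
      fix x y assume "x \<in> B" "y \<in> B"
      then obtain s t where st: "s \<in> S" "t \<in> S" "x \<in> b s" "y \<in> b t" by (auto simp: B_def)
      show "cinner x y = (if x = y then 1 else 0)"
      proof (cases "s = t")
        case True
        then show ?thesis using b(2)[OF st(1)] st unfolding orthonormal_def by auto
      next
        case False
        then have "x \<noteq> y" using disj st by blast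
        then show ?thesis using orth False st by simp
      qed
    qed
    show "B \<subseteq> X" using b(3) by (auto simp: B_def eigenspace_def)
    show "\<exists>s\<in>S. T x = complex_of_real s *\<^sub>C x" if "x \<in> B" for x
      using that b(3) by (fastforce simp: B_def eigenspace_def)
    show "eigenspace X T (complex_of_real s) \<subseteq> complex_vector.span B" if "s \<in> S" for s
      using b(4)[OF that] that complex_vector.span_mono[of "b s" B] by (auto simp: B_def)
    have "card B = (\<Sum>s\<in>S. card (b s))"
      unfolding B_def using b(1) disj \<open>finite S\<close> by (intro card_UN_disjoint) auto
    also have "\<dots> = (\<Sum>s\<in>S. multiplicity_of X T s)"
    proof (rule sum.cong)
      fix s assume "s \<in> S"
      then show "card (b s) = multiplicity_of X T s"
        unfolding multiplicity_of_def
        using complex_vector.dim_eq_card[of "b s"] b orthonormal_independent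
        by (metis complex_vector.span_span)
    qed simp
    finally show "card B = (\<Sum>s\<in>S. multiplicity_of X T s)" .
  qed
qed

lemma multiplicity_pos:
  assumes "linear_operator X T" "t \<in> real_eigenvalues X T"
    and "finite_dimensional (eigenspace X T (complex_of_real t))"
  shows "0 < multiplicity_of X T t"
proof -
  obtain B where B: "finite B" "orthonormal B" "B \<subseteq> eigenspace X T (complex_of_real t)"
    "complex_vector.span B = eigenspace X T (complex_of_real t)"
    using orthonormal_basis_exists[OF eigenspace_subspace[OF assms(1)] assms(3)] by metis
  have "B \<noteq> {}" using assms(2) B(4) by (auto simp: real_eigenvalues_def is_eigenvalue_def)
  moreover have "multiplicity_of X T t = card B"
    unfolding multiplicity_of_def B(4)[symmetric]
    using complex_vector.dim_span_eq_card_independent orthonormal_independent B by blast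
  ultimately show ?thesis using B(1) by (simp add: card_gt_0_iff)
qed

text \<open>
  Orthonormal sets of eigenvectors for distinct eigenvalues are independent, which bounds the
  number of eigenvalues. The orthogonal complement \<open>Y\<close> of all eigenvectors is invariant and has no
  eigenvector of its own, so it is trivial.
\<close>
lemma finite_dimensional_spectral_theorem:
  assumes sym: "symmetric_operator X T" and fd: "finite_dimensional X" and inv: "T ` X \<subseteq> X"
  shows "finite (real_eigenvalues X T)"
    and "(\<Sum>s\<in>real_eigenvalues X T. multiplicity_of X T s) = complex_vector.dim X"
proof -
  note lin = symmetric_operator_linear[OF sym]
  note X = linear_operator_subspace[OF lin]
  have fde: "finite_dimensional (eigenspace X T z)" for z
    using finite_dimensional_mono[OF fd] by (auto simp: eigenspace_def)
  obtain C where C: "finite C" "X \<subseteq> complex_vector.span C"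
    using fd by (auto simp: finite_dimensional_def)
  show fin: "finite (real_eigenvalues X T)"
  proof (rule ccontr)
    assume "infinite (real_eigenvalues X T)"
    then obtain S where S: "S \<subseteq> real_eigenvalues X T" "finite S" "card S = Suc (card C)"
      by (meson infinite_arbitrarily_large)
    obtain B where B: "finite B" "orthonormal B" "B \<subseteq> X" "card B = (\<Sum>s\<in>S. multiplicity_of X T s)"
      by (rule eigenbasis_exists[OF sym S(2) fde]) blast
    have "1 \<le> multiplicity_of X T s" if "s \<in> S" for s
      using multiplicity_pos[OF lin _ fde, of s] S(1) that by auto
    then have "card S \<le> (\<Sum>s\<in>S. multiplicity_of X T s)"
      using sum_mono[of S "\<lambda>_. 1" "multiplicity_of X T"] by simp
    also have "\<dots> \<le> card C"
      using complex_vector.independent_span_bound[OF C(1) orthonormal_independent[OF B(1,2)]] B C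
      by auto
    finally show False using S by simp
  qed
  obtain B where B: "finite B" "orthonormal B" "B \<subseteq> X"
    "\<And>b. b \<in> B \<Longrightarrow> \<exists>s\<in>real_eigenvalues X T. T b = complex_of_real s *\<^sub>C b"
    "\<And>s. s \<in> real_eigenvalues X T \<Longrightarrow> eigenspace X T (complex_of_real s) \<subseteq> complex_vector.span B"
    "card B = (\<Sum>s\<in>real_eigenvalues X T. multiplicity_of X T s)"
    by (rule eigenbasis_exists[OF sym fin fde]) blast
  define Y where "Y = {x \<in> X. \<forall>b\<in>B. cinner b x = 0}"
  have Y: "complex_vector.subspace Y"
    using X unfolding complex_vector.subspace_def Y_def
    by (auto simp: cinner_add_right cinner_scaleC_right)
  have Yinv: "T ` Y \<subseteq> Y"
  proof safe
    fix x assume x: "x \<in> Y"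
    have "cinner b (T x) = 0" if "b \<in> B" for b
    proof -
      obtain s where "T b = complex_of_real s *\<^sub>C b" using B(4)[OF \<open>b \<in> B\<close>] by blast
      moreover have "cinner b (T x) = cinner (T b) x"
        using symmetric_operatorD[OF sym, of b x] B(3) x that by (auto simp: Y_def)
      ultimately show ?thesis using x that by (simp add: Y_def cinner_scaleC_left)
    qed
    then show "T x \<in> Y" using x inv by (auto simp: Y_def)
  qed
  have "Y = {0}"
  proof (rule ccontr)
    assume "Y \<noteq> {0}"
    moreover have "symmetric_operator Y T"
      by (rule symmetric_operator_mono[OF sym Y]) (auto simp: Y_def)
    moreover have "finite_dimensional Y"
      using finite_dimensional_mono[OF fd] by (auto simp: Y_def)
    ultimately obtain t x where x: "x \<in> Y" "x \<noteq> 0" "T x = complex_of_real t *\<^sub>C x"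
      using symmetric_has_eigenvector Yinv by metis
    then have "x \<in> eigenspace X T (complex_of_real t)" by (simp add: eigenspace_def Y_def)
    moreover from this have "t \<in> real_eigenvalues X T"
      using x by (auto simp: real_eigenvalues_def is_eigenvalue_def)
    ultimately have "x \<in> complex_vector.span B" using B(5) by blast
    then have "cinner x x = 0"
      using x(1) by (intro cinner_span_eq_zero[of B x x]) (auto simp: Y_def)
    then show False using x by (simp add: cinner_eq_zero_iff)
  qed
  have "x \<in> complex_vector.span B" if "x \<in> X" for x
  proof -
    have "expansion B x \<in> X"
      using expansion_in_span complex_vector.span_minimal[OF B(3) X] by blast
    then have "x - expansion B x \<in> Y"
      using X that complex_vector.subspace_diff expansion_residual[OF B(1,2)]
      by (auto simp: Y_def complex_vector.span_base)
    then show ?thesis using \<open>Y = {0}\<close> expansion_in_span[of B x] by auto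
  qed
  then show "(\<Sum>s\<in>real_eigenvalues X T. multiplicity_of X T s) = complex_vector.dim X"
    using complex_vector.basis_card_eq_dim[OF B(3) _ orthonormal_independent[OF B(1,2)]] B(6)
    by (simp add: subset_iff)
qed

text \<open>
  Otherwise the projection onto the span of \<open>B\<close> would be injective on the span of \<open>C\<close> and map
  \<open>C\<close> to too many independent vectors.
\<close>
lemma orthogonal_vector_exists:
  assumes B: "finite B" "orthonormal B" and C: "finite C" "orthonormal C" and "card B < card C"
  obtains x where "x \<in> complex_vector.span C" "x \<noteq> 0" "\<And>b. b \<in> B \<Longrightarrow> cinner b x = 0"
proof (rule ccontr)
  assume "\<not> thesis"
  with that have none: "x = 0" if "x \<in> complex_vector.span C" "\<And>b. b \<in> B \<Longrightarrow> cinner b x = 0" for x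
    using that by blast
  have inj: "x = 0" if "x \<in> complex_vector.span C" "expansion B x = 0" for x
    using none[OF that(1)] expansion_residual[OF B complex_vector.span_base, of _ x] that(2) by simp
  note lin = expansion_linear[of B]
  have "inj_on (expansion B) C"
  proof (rule inj_onI)
    fix x y assume "x \<in> C" "y \<in> C" "expansion B x = expansion B y"
    then have "expansion B (x - y) = 0" by (simp add: linear_operator_diff[OF lin])
    then show "x = y" using inj[of "x - y"] \<open>x \<in> C\<close> \<open>y \<in> C\<close>
      by (simp add: complex_vector.span_diff complex_vector.span_base)
  qed
  moreover have "complex_vector.independent (expansion B ` C)"
    unfolding complex_vector.dependent_finite[OF finite_imageI[OF C(1)]]
  proof
    assume "\<exists>u. (\<exists>v\<in>expansion B ` C. u v \<noteq> 0) \<and> (\<Sum>v\<in>expansion B ` C. u v *\<^sub>C v) = 0"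
    then obtain u c where u: "(\<Sum>v\<in>expansion B ` C. u v *\<^sub>C v) = 0"
      and c: "c \<in> C" "u (expansion B c) \<noteq> 0" by blast
    have "(\<Sum>v\<in>expansion B ` C. u v *\<^sub>C v) = expansion B (\<Sum>c\<in>C. u (expansion B c) *\<^sub>C c)"
      using \<open>inj_on (expansion B) C\<close> linear_operator_sum[OF lin, of C "\<lambda>c. c"]
      by (simp add: sum.reindex)
    moreover have "(\<Sum>c\<in>C. u (expansion B c) *\<^sub>C c) \<in> complex_vector.span C"
      by (intro complex_vector.span_sum complex_vector.span_scale complex_vector.span_base)
    ultimately have "(\<Sum>c\<in>C. u (expansion B c) *\<^sub>C c) = 0"
      using inj u by metis
    then show False using c orthonormal_cinner_sum[OF C c(1), of "\<lambda>c. u (expansion B c)"] by simp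
  qed
  moreover have "expansion B ` C \<subseteq> complex_vector.span B" using expansion_in_span by blast
  ultimately have "card C \<le> card B"
    using complex_vector.independent_span_bound[OF B(1), of "expansion B ` C"] by (simp add: card_image)
  then show False using assms(5) by simp
qed

section \<open>Self-adjoint operators outside the essential spectrum\<close>

lemma self_adjoint_symmetric:
  assumes "self_adjoint D T"
  shows "symmetric_operator D T"
proof -
  have "cinner (T x) y = cinner x (T y)" if "x \<in> D" "y \<in> D" for x y
  proof -
    have "(x, T x) \<in> adjoint_graph D T" using assms that by (auto simp: self_adjoint_def)
    then show ?thesis using that by (simp add: adjoint_graph_def)
  qed
  then show ?thesis using assms by (simp add: symmetric_operator_def self_adjoint_def)
qed

lemma self_adjoint_domainI:
  assumes "self_adjoint D T" and "\<And>x. x \<in> D \<Longrightarrow> cinner y (T x) = cinner z x"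
  shows "y \<in> D" "T y = z"
proof -
  have "(y, z) \<in> (\<lambda>x. (x, T x)) ` D"
    using assms unfolding self_adjoint_def adjoint_graph_def by blast
  then show "y \<in> D" "T y = z" by auto
qed

lemma bounded_inverse_bounded_below:
  assumes "has_bounded_inverse D S"
  obtains e where "0 < e" "\<And>x. x \<in> D \<Longrightarrow> e * norm x \<le> norm (S x)"
proof -
  have bij: "bij_betw S D UNIV" and bl: "bounded_linear (inv_into D S)"
    using assms by (auto simp: has_bounded_inverse_def)
  obtain K where K: "0 < K" "\<And>y. norm (inv_into D S y) \<le> norm y * K"
    using bounded_linear.pos_bounded[OF bl] by blast
  have "1 / K * norm x \<le> norm (S x)" if "x \<in> D" for x
    using K(2)[of "S x"] K(1) that inv_into_f_f[OF bij_betw_imp_inj_on[OF bij] that]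
    by (simp add: field_simps)
  then show ?thesis using that[of "1 / K"] K(1) by simp
qed

lemma resolvent_image:
  assumes "z \<notin> spectrum D T"
  shows "(\<lambda>x. T x - z *\<^sub>C x) ` D = UNIV"
  using assms by (simp add: spectrum_def has_bounded_inverse_def bij_betw_def)

lemma resolvent_local_gap:
  assumes "complex_of_real t \<notin> spectrum D T"
  obtains e where "0 < e" "spectral_gap D T (t - e) (t + e)"
proof -
  have "has_bounded_inverse D (\<lambda>x. T x - complex_of_real t *\<^sub>C x)"
    using assms by (simp add: spectrum_def)
  then obtain e where "0 < e" "\<And>x. x \<in> D \<Longrightarrow> e * norm x \<le> norm (T x - complex_of_real t *\<^sub>C x)"
    by (rule bounded_inverse_bounded_below) blast
  then show ?thesis using that spectral_gap_bounded_below[of e D T t] by auto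
qed

lemma real_eigenvalues_iff:
  "t \<in> real_eigenvalues D T \<longleftrightarrow> (\<exists>x\<in>D. x \<noteq> 0 \<and> T x = complex_of_real t *\<^sub>C x)"
  by (auto simp: real_eigenvalues_def is_eigenvalue_def eigenspace_def)

lemma eigenvalue_in_spectrum:
  assumes "linear_operator D T" "t \<in> real_eigenvalues D T"
  shows "complex_of_real t \<in> spectrum D T"
proof (rule ccontr)
  assume "complex_of_real t \<notin> spectrum D T"
  then have "inj_on (\<lambda>x. T x - complex_of_real t *\<^sub>C x) D"
    by (simp add: spectrum_def has_bounded_inverse_def bij_betw_def)
  moreover obtain x where x: "x \<in> D" "x \<noteq> 0" "T x = complex_of_real t *\<^sub>C x"
    using assms(2) by (auto simp: real_eigenvalues_iff)
  moreover have "0 \<in> D"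
    using assms(1) linear_operator_subspace complex_vector.subspace_0 by blast
  ultimately show False
    using inj_onD[of "\<lambda>x. T x - complex_of_real t *\<^sub>C x" D x 0] linear_operator_zero[OF assms(1)]
    by simp
qed

text \<open>
  Inside the interval the local gaps glue; the end points, which may belong to the spectrum, are
  reached by continuity of the gap form.
\<close>
lemma resolvent_interval_gap:
  assumes sa: "self_adjoint D T" and "a < b"
    and res: "\<And>t. a < t \<Longrightarrow> t < b \<Longrightarrow> complex_of_real t \<notin> spectrum D T"
  shows "spectral_gap D T a b"
  unfolding spectral_gap_def
proof
  fix x assume x: "x \<in> D"
  define h where "h \<delta> = (norm (T x))\<^sup>2 + (a + \<delta>) * (b - \<delta>) * (norm x)\<^sup>2 - (a + b) * ip (T x) x" for \<delta>
  have "0 \<le> h \<delta>" if "0 < \<delta>" "\<delta> < (b - a) / 2" for \<delta>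
  proof -
    have "spectral_gap D T (a + \<delta>) (b - \<delta>)"
    proof (rule spectral_gap_from_local[OF self_adjoint_symmetric[OF sa]])
      fix t assume "a + \<delta> \<le> t" "t \<le> b - \<delta>"
      then have t: "complex_of_real t \<notin> spectrum D T" using that by (intro res) auto
      show "D \<subseteq> closure ((\<lambda>x. T x - complex_of_real t *\<^sub>C x) ` D)"
        unfolding resolvent_image[OF t] by simp
      show "\<exists>e>0. spectral_gap D T (t - e) (t + e)"
        by (rule resolvent_local_gap[OF t]) blast
    qed (use that in \<open>simp add: field_simps\<close>)
    then show ?thesis using x by (auto simp: spectral_gap_def h_def)
  qed
  then have "eventually (\<lambda>\<delta>. 0 \<le> h \<delta>) (at_right 0)"
    using \<open>a < b\<close> unfolding eventually_at_right_field by (intro exI[of _ "(b - a) / 2"]) auto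
  moreover have "(h \<longlongrightarrow> h 0) (at_right 0)"
    unfolding h_def by (auto intro!: tendsto_eq_intros)
  ultimately have "0 \<le> h 0"
    by (intro tendsto_lowerbound[of h "h 0" "at_right 0" 0]) auto
  then show "(a + b) * ip (T x) x \<le> (norm (T x))\<^sup>2 + a * b * (norm x)\<^sup>2"
    by (simp add: h_def)
qed

lemma orthogonal_part_subspace:
  "complex_vector.subspace D \<Longrightarrow> complex_vector.subspace {x \<in> D. \<forall>b\<in>B. cinner b x = 0}"
  unfolding complex_vector.subspace_def by (auto simp: cinner_add_right cinner_scaleC_right)

text \<open>
  The orthogonal complement of the finite dimensional invariant subspace spanned by \<open>B\<close> reduces \<open>T\<close>.
  A vector \<open>z\<close> in it that is orthogonal to \<open>(T - t) X\<close> is orthogonal to the whole range of \<open>T - t\<close>,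
  hence lies in the domain of the adjoint, which is \<open>T\<close>, with \<open>T z = t z\<close>, and vanishes by the absence of
  eigenvectors.
\<close>
lemma dense_range_on_orthogonal_part:
  fixes T :: "'a::chilbert_space \<Rightarrow> 'a"
  assumes sa: "self_adjoint D T" and B: "finite B" "orthonormal B" "B \<subseteq> D"
    and inv: "\<And>b. b \<in> B \<Longrightarrow> T b \<in> complex_vector.span B"
    and X_def: "X = {x \<in> D. \<forall>b\<in>B. cinner b x = 0}"
    and none: "\<And>x. x \<in> X \<Longrightarrow> T x = complex_of_real t *\<^sub>C x \<Longrightarrow> x = 0"
  shows "X \<subseteq> closure ((\<lambda>x. T x - complex_of_real t *\<^sub>C x) ` X)"
proof
  fix x assume x: "x \<in> X"
  define S where "S = (\<lambda>x. T x - complex_of_real t *\<^sub>C x)"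
  note sym = self_adjoint_symmetric[OF sa]
  note lin = symmetric_operator_linear[OF sym]
  note D = linear_operator_subspace[OF lin]
  have linS: "linear_operator D S" unfolding S_def by (rule linear_operator_shift[OF lin])
  have XD: "X \<subseteq> D" by (auto simp: X_def)
  have X: "complex_vector.subspace X" unfolding X_def by (rule orthogonal_part_subspace[OF D])
  have invS: "S b \<in> complex_vector.span B" if "b \<in> B" for b
    unfolding S_def using inv[OF that] that
    by (simp add: complex_vector.span_diff complex_vector.span_scale complex_vector.span_base)
  have S_orth: "cinner b (S k) = 0" "cinner (S k) b = 0" if "k \<in> X" "b \<in> B" for k b
  proof -
    have "cinner b (S k) = cinner (S b) k"
      unfolding S_def using that B(3) XD
      by (intro symmetric_operatorD[OF symmetric_operator_shift[OF sym], symmetric]) auto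
    also have "\<dots> = 0"
      using that(1) by (intro cinner_span_eq_zero[OF _ invS[OF that(2)]]) (auto simp: X_def)
    finally show "cinner b (S k) = 0" .
    then show "cinner (S k) b = 0" by (metis cinner_commute complex_cnj_zero)
  qed
  have "complex_vector.subspace (S ` X)"
    by (rule linear_image_subspace[OF linear_operator_mono[OF linS X XD]])
  then obtain r where r: "r \<in> closure (S ` X)" "\<And>s. s \<in> S ` X \<Longrightarrow> cinner s (x - r) = 0"
    by (rule projection_on_closure[of "S ` X" x]) blast
  define z where "z = x - r"
  have zB: "cinner b z = 0" "cinner z b = 0" if "b \<in> B" for b
  proof -
    have "cinner r b = 0" using cinner_eq_zero_closure[of "S ` X" b r] S_orth that r(1) by blast
    then have "cinner b r = 0" by (metis cinner_commute complex_cnj_zero)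
    then show "cinner b z = 0" using x that by (simp add: z_def X_def cinner_diff_right)
    then show "cinner z b = 0" by (metis cinner_commute complex_cnj_zero)
  qed
  have "cinner z (T y) = cinner (complex_of_real t *\<^sub>C z) y" if y: "y \<in> D" for y
  proof -
    define f where "f = expansion B y"
    have f: "f \<in> complex_vector.span B" unfolding f_def by (rule expansion_in_span)
    then have fD: "f \<in> D" using complex_vector.span_minimal[OF B(3) D] by blast
    have "y - f \<in> X"
      using expansion_residual[OF B(1,2) complex_vector.span_base] y fD D
      by (auto simp: X_def f_def complex_vector.subspace_diff)
    then have "cinner (S (y - f)) z = 0" using r(2) unfolding z_def by blast
    then have 1: "cinner z (S y - S f) = 0"
      using linear_operator_diff[OF linS y fD] by (metis cinner_commute complex_cnj_zero)
    have "S f = (\<Sum>b\<in>B. cinner b y *\<^sub>C S b)"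
      unfolding f_def expansion_def using B(3) by (intro linear_operator_sum[OF linS]) auto
    then have "S f \<in> complex_vector.span B"
      using invS by (auto intro!: complex_vector.span_sum complex_vector.span_scale)
    then have "cinner (S f) z = 0" using zB(1) cinner_span_eq_zero by blast
    then have "cinner z (S f) = 0" by (metis cinner_commute complex_cnj_zero)
    with 1 have "cinner z (S y) = 0" by (simp add: cinner_diff_right)
    then show ?thesis by (simp add: S_def cinner_algebra)
  qed
  then have z: "z \<in> D" "T z = complex_of_real t *\<^sub>C z"
    using self_adjoint_domainI[OF sa] by blast+
  then have "z = 0" using zB(1) by (intro none) (auto simp: X_def)
  then show "x \<in> closure ((\<lambda>x. T x - complex_of_real t *\<^sub>C x) ` X)"
    using r(1) by (simp add: z_def S_def)
qed

lemma discrete_eigenvalue_isolated: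
  assumes "complex_of_real t \<in> discrete_spectrum D T"
  obtains e where "0 < e" "\<And>s. s \<noteq> t \<Longrightarrow> \<bar>s - t\<bar> < e \<Longrightarrow> complex_of_real s \<notin> spectrum D T"
proof -
  obtain e where e: "0 < e" "\<And>y. y \<in> spectrum D T \<Longrightarrow> dist (complex_of_real t) y < e \<Longrightarrow> y = complex_of_real t"
    using assms unfolding discrete_spectrum_def isolated_in_dist_Ex_iff by blast
  have "complex_of_real s \<notin> spectrum D T" if "s \<noteq> t" "\<bar>s - t\<bar> < e" for s
  proof
    assume "complex_of_real s \<in> spectrum D T"
    moreover have "dist (complex_of_real t) (complex_of_real s) < e"
      using that(2) by (simp add: dist_norm abs_minus_commute flip: of_real_diff)
    ultimately show False using e(2) that(1) by force
  qed
  then show ?thesis using that e(1) by blast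
qed

lemma non_essential_eigenvalue_isolated:
  assumes sa: "self_adjoint D T" and t: "complex_of_real t \<notin> essential_spectrum D T"
  obtains e where "0 < e" "\<And>s. s \<in> real_eigenvalues D T \<Longrightarrow> \<bar>s - t\<bar> < e \<Longrightarrow> s = t"
proof (cases "complex_of_real t \<in> spectrum D T")
  case True
  then have "complex_of_real t \<in> discrete_spectrum D T" using t by (simp add: essential_spectrum_def)
  then obtain e where "0 < e" "\<And>s. s \<noteq> t \<Longrightarrow> \<bar>s - t\<bar> < e \<Longrightarrow> complex_of_real s \<notin> spectrum D T"
    by (rule discrete_eigenvalue_isolated) blast
  then show ?thesis
    using that eigenvalue_in_spectrum[OF symmetric_operator_linear[OF self_adjoint_symmetric[OF sa]]]
    by metis
next
  case False
  then obtain e where e: "0 < e" "spectral_gap D T (t - e) (t + e)" by (rule resolvent_local_gap)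
  show ?thesis
  proof (rule that[OF e(1)])
    fix s assume "s \<in> real_eigenvalues D T" "\<bar>s - t\<bar> < e"
    then show "s = t"
      using spectral_gap_no_eigenvector[OF e(2), of s] by (auto simp: real_eigenvalues_iff abs_less_iff)
  qed
qed

text \<open>
  If \<open>t\<close> lies in the spectrum, it is isolated, so there are gaps on either side of it on all of \<open>D\<close>.
  They merge across \<open>t\<close> on a subspace on which \<open>T - t\<close> has dense range.
\<close>
lemma non_essential_local_gap:
  assumes sa: "self_adjoint D T" and t: "complex_of_real t \<notin> essential_spectrum D T"
    and XD: "X \<subseteq> D" and X: "complex_vector.subspace X"
    and dense: "X \<subseteq> closure ((\<lambda>x. T x - complex_of_real t *\<^sub>C x) ` X)"
  obtains e where "0 < e" "spectral_gap X T (t - e) (t + e)"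
proof (cases "complex_of_real t \<in> spectrum D T")
  case True
  then have "complex_of_real t \<in> discrete_spectrum D T" using t by (simp add: essential_spectrum_def)
  then obtain e where e: "0 < e" "\<And>s. s \<noteq> t \<Longrightarrow> \<bar>s - t\<bar> < e \<Longrightarrow> complex_of_real s \<notin> spectrum D T"
    by (rule discrete_eigenvalue_isolated) blast
  have "spectral_gap D T (t - e) t" "spectral_gap D T t (t + e)"
    using e by (auto intro!: resolvent_interval_gap[OF sa])
  then have "spectral_gap X T (t - e) (t + e)"
    using spectral_gap_merge[OF symmetric_operator_mono[OF self_adjoint_symmetric[OF sa] X XD] dense]
      spectral_gap_mono[OF _ XD] e(1) by simp
  then show ?thesis using that e(1) by blast
next
  case False
  then obtain e where e: "0 < e" "spectral_gap D T (t - e) (t + e)" by (rule resolvent_local_gap)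
  then show ?thesis using that spectral_gap_mono[OF _ XD] by blast
qed

lemma finite_eigenvalues_non_essential:
  assumes sa: "self_adjoint D T"
    and ess: "\<And>t. a \<le> t \<Longrightarrow> t \<le> b \<Longrightarrow> complex_of_real t \<notin> essential_spectrum D T"
  shows "finite {s \<in> real_eigenvalues D T. a \<le> s \<and> s \<le> b}"
proof (cases "a \<le> b")
  case True
  define P where "P u v \<longleftrightarrow> finite {s \<in> real_eigenvalues D T. u \<le> s \<and> s \<le> v}" for u v
  have "P a b"
  proof (rule Bolzano[OF True])
    fix u v w assume "P u v" "P v w" "u \<le> v" "v \<le> w"
    moreover have "{s \<in> real_eigenvalues D T. u \<le> s \<and> s \<le> w} \<subseteq>
      {s \<in> real_eigenvalues D T. u \<le> s \<and> s \<le> v} \<union> {s \<in> real_eigenvalues D T. v \<le> s \<and> s \<le> w}"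
      by auto
    ultimately show "P u w" unfolding P_def by (meson finite_UnI finite_subset)
  next
    fix t assume "a \<le> t" "t \<le> b"
    then obtain e where e: "0 < e" "\<And>s. s \<in> real_eigenvalues D T \<Longrightarrow> \<bar>s - t\<bar> < e \<Longrightarrow> s = t"
      using non_essential_eigenvalue_isolated[OF sa ess] by metis
    have "P u v" if "u \<le> t" "t \<le> v" "v - u < e" for u v
    proof -
      have "{s \<in> real_eigenvalues D T. u \<le> s \<and> s \<le> v} \<subseteq> {t}"
        using that e(2) by (auto simp: abs_less_iff)
      then show ?thesis unfolding P_def by (meson finite.emptyI finite_insert finite_subset)
    qed
    then show "\<exists>e>0. \<forall>u v. u \<le> t \<and> t \<le> v \<and> v - u < e \<longrightarrow> P u v" using e(1) by blast
  qed
  then show ?thesis by (simp add: P_def)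
qed (auto intro: finite_subset[of _ "{}"])

lemma non_essential_eigenspace:
  assumes "linear_operator D T" "t \<in> real_eigenvalues D T"
    and "complex_of_real t \<notin> essential_spectrum D T"
  shows "finite_dimensional (eigenspace D T (complex_of_real t))"
  using eigenvalue_in_spectrum[OF assms(1,2)] assms(3)
  by (auto simp: essential_spectrum_def discrete_spectrum_def)

text \<open>
  Off the eigenvectors the local gaps glue to one on \<open>[a, b]\<close>, and the local gaps around \<open>a\<close> and \<open>b\<close>
  extend it to \<open>[a - e, b + e]\<close>. The enlargement is what makes the inequality strict.
\<close>
lemma spectral_gap_off_eigenvectors:
  fixes T :: "'a::chilbert_space \<Rightarrow> 'a"
  assumes sa: "self_adjoint D T" and "a \<le> b"
    and ess: "\<And>t. a \<le> t \<Longrightarrow> t \<le> b \<Longrightarrow> complex_of_real t \<notin> essential_spectrum D T"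
    and B: "finite B" "orthonormal B" "B \<subseteq> D"
    and Beig: "\<And>b. b \<in> B \<Longrightarrow> \<exists>s. T b = complex_of_real s *\<^sub>C b"
    and Bspan: "\<And>t. a \<le> t \<Longrightarrow> t \<le> b \<Longrightarrow> t \<in> real_eigenvalues D T \<Longrightarrow>
      eigenspace D T (complex_of_real t) \<subseteq> complex_vector.span B"
    and x: "x \<in> D" "x \<noteq> 0" "\<And>b. b \<in> B \<Longrightarrow> cinner b x = 0"
  shows "(a + b) * ip (T x) x < (norm (T x))\<^sup>2 + a * b * (norm x)\<^sup>2"
proof -
  define X where "X = {x \<in> D. \<forall>b\<in>B. cinner b x = 0}"
  note sym = self_adjoint_symmetric[OF sa]
  note D = linear_operator_subspace[OF symmetric_operator_linear[OF sym]]
  have XD: "X \<subseteq> D" by (auto simp: X_def)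
  have X: "complex_vector.subspace X" unfolding X_def by (rule orthogonal_part_subspace[OF D])
  note symX = symmetric_operator_mono[OF sym X XD]
  have inv: "T b \<in> complex_vector.span B" if "b \<in> B" for b
    using Beig[OF that] that complex_vector.span_scale complex_vector.span_base by metis
  have none: "x = 0" if "a \<le> t" "t \<le> b" "x \<in> X" "T x = complex_of_real t *\<^sub>C x" for t x
  proof (rule ccontr)
    assume "x \<noteq> 0"
    then have "t \<in> real_eigenvalues D T" using that XD by (auto simp: real_eigenvalues_iff)
    then have "x \<in> complex_vector.span B"
      using Bspan[OF that(1,2)] that XD by (auto simp: eigenspace_def)
    then have "cinner x x = 0"
      using that(3) by (intro cinner_span_eq_zero[of B x x]) (auto simp: X_def)
    then show False using \<open>x \<noteq> 0\<close> by (simp add: cinner_eq_zero_iff)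
  qed
  have dense: "X \<subseteq> closure ((\<lambda>x. T x - complex_of_real t *\<^sub>C x) ` X)" if "a \<le> t" "t \<le> b" for t
    by (rule dense_range_on_orthogonal_part[OF sa B inv X_def none[OF that]])
  have loc: "\<exists>e>0. spectral_gap X T (t - e) (t + e)" if "a \<le> t" "t \<le> b" for t
    by (rule non_essential_local_gap[OF sa ess[OF that] XD X dense[OF that]]) blast
  obtain e1 where e1: "0 < e1" "spectral_gap X T (a - e1) (a + e1)" using loc[of a] \<open>a \<le> b\<close> by auto
  obtain e2 where e2: "0 < e2" "spectral_gap X T (b - e2) (b + e2)" using loc[of b] \<open>a \<le> b\<close> by auto
  define e where "e = min e1 e2"
  have "0 < e" using e1 e2 by (simp add: e_def)
  have "spectral_gap X T a b" by (rule spectral_gap_from_local[OF symX \<open>a \<le> b\<close> dense loc])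
  moreover have "spectral_gap X T (a - e) a" "spectral_gap X T b (b + e)"
    using e1 e2 by (auto simp: e_def intro: spectral_gap_shrink[OF e1(2)] spectral_gap_shrink[OF e2(2)])
  ultimately have "spectral_gap X T (a - e) b"
    using spectral_gap_merge[OF symX dense, of a "a - e" b] \<open>a \<le> b\<close> \<open>0 < e\<close> by simp
  then have "spectral_gap X T (a - e) (b + e)"
    using spectral_gap_merge[OF symX dense, of b "a - e" "b + e"] \<open>a \<le> b\<close> \<open>0 < e\<close>
      \<open>spectral_gap X T b (b + e)\<close> by simp
  then have "(a - e + (b + e)) * ip (T x) x \<le> (norm (T x))\<^sup>2 + (a - e) * (b + e) * (norm x)\<^sup>2"
    using x unfolding spectral_gap_def X_def by blast
  also have "(a - e) * (b + e) * (norm x)\<^sup>2 < a * b * (norm x)\<^sup>2"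
  proof (rule mult_strict_right_mono)
    have "0 \<le> e * (b - a)" "0 < e * e" using \<open>0 < e\<close> \<open>a \<le> b\<close> by simp_all
    then show "(a - e) * (b + e) < a * b" by (simp add: algebra_simps)
  qed (use x in simp)
  finally show ?thesis by (simp add: algebra_simps)
qed

section \<open>Comparing the eigenvalues of an operator and of its compression\<close>

text \<open>
  A failure of the inequality provides a nonzero combination \<open>x\<close> of the eigenvectors of \<open>M\<close> for
  \<open>[p, q]\<close> that is orthogonal to the eigenvectors of \<open>H\<close> for \<open>[p / (1 + \<eta>), q / (1 - \<eta>)]\<close>. The gap of
  \<open>H\<close> at \<open>x\<close> contradicts the estimate \<open>(1 - \<eta>\<^sup>2) \<parallel>H x\<parallel>\<^sup>2 \<le> \<parallel>M x\<parallel>\<^sup>2 \<le> (p + q) \<langle>M x, x\<rangle> - p q \<parallel>x\<parallel>\<^sup>2\<close>.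
\<close>
lemma compression_eigenvalue_count:
  fixes H M :: "'a::chilbert_space \<Rightarrow> 'a"
  assumes sa: "self_adjoint D H" and symM: "symmetric_operator U M"
    and fd: "finite_dimensional U" and UD: "U \<subseteq> D" and inv: "M ` U \<subseteq> U"
    and orth: "\<And>x y. x \<in> U \<Longrightarrow> y \<in> U \<Longrightarrow> cinner y (H x - M x) = 0"
    and resid: "\<And>x. x \<in> U \<Longrightarrow> norm (H x - M x) \<le> \<eta> * norm (H x)"
    and \<eta>: "0 \<le> \<eta>" "\<eta> < 1" and pq: "0 < p" "p \<le> q"
    and ess: "\<And>t. p / (1 + \<eta>) \<le> t \<Longrightarrow> t \<le> q / (1 - \<eta>) \<Longrightarrow>
      complex_of_real t \<notin> essential_spectrum D H"
  shows "(\<Sum>s\<in>{s \<in> real_eigenvalues U M. p \<le> s \<and> s \<le> q}. multiplicity_of U M s)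
    \<le> (\<Sum>s\<in>{s \<in> real_eigenvalues D H. p / (1 + \<eta>) \<le> s \<and> s \<le> q / (1 - \<eta>)}. multiplicity_of D H s)"
    (is "sum _ ?SM \<le> sum _ ?SH")
proof -
  define \<alpha> where "\<alpha> = p / (1 + \<eta>)"
  define \<beta> where "\<beta> = q / (1 - \<eta>)"
  note symH = self_adjoint_symmetric[OF sa]
  have "\<alpha> \<le> p / 1" unfolding \<alpha>_def using \<eta> pq by (intro divide_left_mono) auto
  also have "p / 1 \<le> q / 1" using pq by simp
  also have "q / 1 \<le> \<beta>" unfolding \<beta>_def using \<eta> pq by (intro divide_left_mono) auto
  finally have "\<alpha> \<le> \<beta>" .
  have finM: "finite ?SM" using finite_dimensional_spectral_theorem(1)[OF symM fd inv] by simp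
  have finH: "finite ?SH" using finite_eigenvalues_non_essential[OF sa ess] .
  have fdM: "finite_dimensional (eigenspace U M (complex_of_real s))" for s
    using finite_dimensional_mono[OF fd] by (auto simp: eigenspace_def)
  have fdH: "finite_dimensional (eigenspace D H (complex_of_real s))" if "s \<in> ?SH" for s
    using that non_essential_eigenspace[OF symmetric_operator_linear[OF symH] _ ess] by blast
  obtain C where C: "finite C" "orthonormal C" "C \<subseteq> U"
    "\<And>b. b \<in> C \<Longrightarrow> \<exists>s\<in>?SM. M b = complex_of_real s *\<^sub>C b"
    "\<And>s. s \<in> ?SM \<Longrightarrow> eigenspace U M (complex_of_real s) \<subseteq> complex_vector.span C"
    "card C = sum (multiplicity_of U M) ?SM"
    by (rule eigenbasis_exists[OF symM finM fdM]) blast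
  obtain B where B: "finite B" "orthonormal B" "B \<subseteq> D"
    "\<And>b. b \<in> B \<Longrightarrow> \<exists>s\<in>?SH. H b = complex_of_real s *\<^sub>C b"
    "\<And>s. s \<in> ?SH \<Longrightarrow> eigenspace D H (complex_of_real s) \<subseteq> complex_vector.span B"
    "card B = sum (multiplicity_of D H) ?SH"
    by (rule eigenbasis_exists[OF symH finH fdH]) blast+
  show ?thesis
  proof (rule ccontr)
    assume "\<not> ?thesis"
    then have "card B < card C" using B(6) C(6) by simp
    then obtain x where x: "x \<in> complex_vector.span C" "x \<noteq> 0" "\<And>b. b \<in> B \<Longrightarrow> cinner b x = 0"
      using orthogonal_vector_exists[OF B(1,2) C(1,2)] by blast
    note U = linear_operator_subspace[OF symmetric_operator_linear[OF symM]]
    have xU: "x \<in> U" using x(1) complex_vector.span_minimal[OF C(3) U] by blast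
    define m where "m = ip (M x) x"
    define N where "N = (norm x)\<^sup>2"
    define h where "h = (norm (H x))\<^sup>2"
    have strict: "0 < h - (\<alpha> + \<beta>) * ip (H x) x + \<alpha> * \<beta> * N"
      using spectral_gap_off_eigenvectors[OF sa \<open>\<alpha> \<le> \<beta>\<close> _ B(1-3) _ _ _ x(2,3)] ess B(4,5) xU UD
      unfolding h_def N_def \<alpha>_def \<beta>_def by fastforce
    have "ip (H x) x = m"
      using orth[OF xU xU] by (metis m_def ip_def cinner_diff_right ip_commute eq_iff_diff_eq_0)
    obtain s where s: "\<And>b. b \<in> C \<Longrightarrow> p \<le> s b \<and> s b \<le> q \<and> M b = complex_of_real (s b) *\<^sub>C b"
      using C(4) by (simp add: Bex_def) metis
    define c where "c b = cinner b x" for b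
    have x_sum: "x = (\<Sum>b\<in>C. c b *\<^sub>C b)"
      using expansion_id[OF C(1,2) x(1)] by (simp add: expansion_def c_def)
    have "M x = (\<Sum>b\<in>C. c b *\<^sub>C M b)"
      using linear_operator_sum[OF symmetric_operator_linear[OF symM], of C "\<lambda>b. b" c] C(3) x_sum
      by auto
    also have "\<dots> = (\<Sum>b\<in>C. (c b * complex_of_real (s b)) *\<^sub>C b)"
      using s by (intro sum.cong) (auto simp: scaleC_scaleC)
    finally have Mx_sum: "M x = (\<Sum>b\<in>C. (c b * complex_of_real (s b)) *\<^sub>C b)" .
    have cc: "Re (cnj z * z) = (cmod z)\<^sup>2" for z
      by (metis complex_norm_square mult.commute Re_complex_of_real)
    have N_sum: "N = (\<Sum>b\<in>C. (cmod (c b))\<^sup>2)"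
      unfolding N_def ip_self[symmetric] ip_def
      by (subst (1 2) x_sum) (simp add: orthonormal_cinner_sums[OF C(1,2)] cc del: times_complex.sel)
    have m_sum: "m = (\<Sum>b\<in>C. s b * (cmod (c b))\<^sup>2)"
    proof -
      have "Re (cnj (c b * complex_of_real (s b)) * c b) = s b * (cmod (c b))\<^sup>2" for b
        unfolding cc[of "c b", symmetric] by (simp add: algebra_simps)
      moreover have "m = Re (cinner (\<Sum>b\<in>C. (c b * complex_of_real (s b)) *\<^sub>C b) (\<Sum>b\<in>C. c b *\<^sub>C b))"
        using Mx_sum x_sum by (simp add: m_def ip_def)
      ultimately show ?thesis
        unfolding orthonormal_cinner_sums[OF C(1,2)] Re_sum by simp
    qed
    have M_sum: "(norm (M x))\<^sup>2 = (\<Sum>b\<in>C. (s b)\<^sup>2 * (cmod (c b))\<^sup>2)"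
    proof -
      have "Re (cnj (c b * complex_of_real (s b)) * (c b * complex_of_real (s b)))
          = (s b)\<^sup>2 * (cmod (c b))\<^sup>2" for b
        unfolding cc by (simp add: norm_mult power_mult_distrib)
      moreover have "(norm (M x))\<^sup>2 = Re (cinner (\<Sum>b\<in>C. (c b * complex_of_real (s b)) *\<^sub>C b)
          (\<Sum>b\<in>C. (c b * complex_of_real (s b)) *\<^sub>C b))"
        using Mx_sum by (simp add: ip_def flip: ip_self)
      ultimately show ?thesis
        unfolding orthonormal_cinner_sums[OF C(1,2)] Re_sum by simp
    qed
    have "0 \<le> m"
      unfolding m_sum using s pq by (intro sum_nonneg mult_nonneg_nonneg) force+
    have "(norm (M x))\<^sup>2 - (p + q) * m + p * q * N
        = (\<Sum>b\<in>C. ((s b - p) * (s b - q)) * (cmod (c b))\<^sup>2)"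
      unfolding M_sum m_sum N_sum sum_distrib_left
      by (simp add: algebra_simps power2_eq_square flip: sum.distrib sum_subtractf)
    also have "\<dots> \<le> 0"
      using s by (intro sum_nonpos mult_nonpos_nonneg mult_nonneg_nonpos) auto
    finally have Mbound: "(norm (M x))\<^sup>2 \<le> (p + q) * m - p * q * N" by simp
    have "M x \<in> U" using inv xU by blast
    then have "ip (M x) (H x - M x) = 0" using orth[OF xU] by (simp add: ip_def)
    then have "h = (norm (M x))\<^sup>2 + (norm (H x - M x))\<^sup>2"
      using norm_add_sq[of "M x" "H x - M x"] by (simp add: h_def)
    also have "(norm (H x - M x))\<^sup>2 \<le> \<eta>\<^sup>2 * h"
      using power_mono[OF resid[OF xU], of 2] by (simp add: h_def power_mult_distrib)
    finally have hbound: "(1 - \<eta>\<^sup>2) * h \<le> (p + q) * m - p * q * N"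
      using Mbound by (simp add: algebra_simps)
    have pos: "0 < 1 + \<eta>" "0 < 1 - \<eta>" using \<eta> by auto
    have ab: "(1 + \<eta>) * \<alpha> = p" "(1 - \<eta>) * \<beta> = q"
      using pos by (simp_all add: \<alpha>_def \<beta>_def)
    have factor: "1 - \<eta>\<^sup>2 = (1 + \<eta>) * (1 - \<eta>)" by (simp add: algebra_simps power2_eq_square)
    have "(1 - \<eta>\<^sup>2) * (\<alpha> + \<beta>) = ((1 + \<eta>) * \<alpha>) * (1 - \<eta>) + ((1 - \<eta>) * \<beta>) * (1 + \<eta>)"
      "(1 - \<eta>\<^sup>2) * (\<alpha> * \<beta>) = ((1 + \<eta>) * \<alpha>) * ((1 - \<eta>) * \<beta>)"
      unfolding factor by (simp_all only: distrib_left mult_ac)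
    then have sums: "(1 - \<eta>\<^sup>2) * (\<alpha> + \<beta>) = p * (1 - \<eta>) + q * (1 + \<eta>)"
      "(1 - \<eta>\<^sup>2) * (\<alpha> * \<beta>) = p * q"
      unfolding ab .
    have "0 < 1 - \<eta>\<^sup>2" unfolding factor using pos by simp
    then have "0 < (1 - \<eta>\<^sup>2) * (h - (\<alpha> + \<beta>) * m + \<alpha> * \<beta> * N)"
      using strict \<open>ip (H x) x = m\<close> by simp
    also have "\<dots> = (1 - \<eta>\<^sup>2) * h - ((1 - \<eta>\<^sup>2) * (\<alpha> + \<beta>)) * m + ((1 - \<eta>\<^sup>2) * (\<alpha> * \<beta>)) * N"
      by (simp add: algebra_simps)
    also have "\<dots> = (1 - \<eta>\<^sup>2) * h - (p * (1 - \<eta>) + q * (1 + \<eta>)) * m + p * q * N"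
      unfolding sums ..
    also have "\<dots> \<le> (p + q) * m - (p * (1 - \<eta>) + q * (1 + \<eta>)) * m"
      using hbound by simp
    also have "\<dots> = - (\<eta> * (q - p) * m)" by (simp add: algebra_simps)
    also have "\<dots> \<le> 0" using \<eta> pq \<open>0 \<le> m\<close> by simp
    finally show False by simp
  qed
qed

text \<open>
  The smallest \<open>t\<close> whose cumulative count reaches \<open>j\<close> has the two defining properties, and two
  different candidates would contradict the monotonicity of the cumulative counts. The sums in the
  definition vanish on infinite sets, so finiteness of the lower parts of \<open>E\<close> matters here.
\<close>
lemma nth_eigenvalue_exists:
  fixes E :: "real set"
  assumes fin: "\<And>t. t \<in> E \<Longrightarrow> finite {s \<in> E. s \<le> t}" and finb: "finite {s \<in> E. s \<le> b}"
    and j: "0 < j" "j \<le> (\<Sum>s\<in>{s \<in> E. s \<le> b}. multiplicity_of D T s)"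
  shows "nth_eigenvalue D T E j \<in> E" "nth_eigenvalue D T E j \<le> b"
    "(\<Sum>s\<in>{s \<in> E. s < nth_eigenvalue D T E j}. multiplicity_of D T s) < j"
    "j \<le> (\<Sum>s\<in>{s \<in> E. s \<le> nth_eigenvalue D T E j}. multiplicity_of D T s)"
proof -
  let ?le = "\<lambda>t. \<Sum>s\<in>{s \<in> E. s \<le> t}. multiplicity_of D T s"
  let ?lt = "\<lambda>t. \<Sum>s\<in>{s \<in> E. s < t}. multiplicity_of D T s"
  let ?P = "\<lambda>t. t \<in> E \<and> ?lt t < j \<and> j \<le> ?le t"
  define S where "S = {s \<in> E. s \<le> b}"
  have "finite S" using finb by (simp add: S_def)
  have "j \<le> sum (multiplicity_of D T) S" using j(2) by (simp add: S_def)
  then have "S \<noteq> {}" using j(1) by (metis not_le sum.empty)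
  have SM: "Max S \<in> S" using \<open>finite S\<close> \<open>S \<noteq> {}\<close> by (rule Max_in)
  have "{s \<in> E. s \<le> Max S} = S"
    using SM Max_ge[OF \<open>finite S\<close>] by (auto simp: S_def)
  then have ex: "Max S \<in> {t \<in> S. j \<le> ?le t}" using SM j by (simp add: S_def)
  have finR: "finite {t \<in> S. j \<le> ?le t}" using \<open>finite S\<close> by simp
  define t where "t = Min {t \<in> S. j \<le> ?le t}"
  have t: "t \<in> S" "j \<le> ?le t" using Min_in[OF finR] ex unfolding t_def by blast+
  have tE: "t \<in> E" "t \<le> b" using t(1) by (auto simp: S_def)
  have "?lt t < j"
  proof (cases "{s \<in> E. s < t} = {}")
    case True
    then show ?thesis using j(1) by (simp only: sum.empty)
  next
    case False
    define L where "L = {s \<in> E. s < t}"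
    have "finite L" using fin[OF tE(1)] by (rule finite_subset[rotated]) (auto simp: L_def)
    have maxL: "Max L \<in> L" using \<open>finite L\<close> False unfolding L_def[symmetric] by (rule Max_in)
    have "{s \<in> E. s \<le> Max L} = L"
      using maxL Max_ge[OF \<open>finite L\<close>] by (auto simp: L_def)
    moreover have "Max L \<notin> {t \<in> S. j \<le> ?le t}"
      using maxL Min_le[OF finR, of "Max L"] unfolding t_def L_def by fastforce
    moreover have "Max L \<in> S" using maxL tE by (auto simp: L_def S_def)
    ultimately show ?thesis by (simp add: L_def)
  qed
  then have Pt: "?P t" using t tE by simp
  have uniq: "u = t" if "?P u" for u
  proof (rule ccontr)
    have le_lt: "?le v \<le> ?lt w" if "v < w" "w \<in> E" for v w
    proof (rule sum_mono2)
      show "finite {s \<in> E. s < w}"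
        using fin[OF that(2)] by (rule finite_subset[rotated]) auto
    qed (use that in auto)
    assume "u \<noteq> t"
    then have "?le u \<le> ?lt t \<or> ?le t \<le> ?lt u"
      using le_lt[of u t] le_lt[of t u] Pt that by linarith
    then show False using Pt that by linarith
  qed
  have "nth_eigenvalue D T E j = t"
    unfolding nth_eigenvalue_def using Pt uniq by (rule the_equality)
  then show "nth_eigenvalue D T E j \<in> E" "nth_eigenvalue D T E j \<le> b"
    "?lt (nth_eigenvalue D T E j) < j" "j \<le> ?le (nth_eigenvalue D T E j)"
    using Pt tE by simp_all
qed

lemma less_index_imp_le:
  fixes E :: "real set" and w :: "real \<Rightarrow> nat"
  assumes "finite {s \<in> E. s < a}" "(\<Sum>s\<in>{s \<in> E. s < a}. w s) < j" "j \<le> (\<Sum>s\<in>{s \<in> E. s \<le> t}. w s)"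
  shows "a \<le> t"
proof (rule ccontr)
  assume "\<not> a \<le> t"
  then have "(\<Sum>s\<in>{s \<in> E. s \<le> t}. w s) \<le> (\<Sum>s\<in>{s \<in> E. s < a}. w s)"
    using assms(1) by (intro sum_mono2) auto
  then show False using assms by linarith
qed

lemma sum_le_split:
  fixes E :: "real set" and w :: "real \<Rightarrow> nat"
  assumes "finite {s \<in> E. s \<le> b}" "a \<le> b"
  shows "(\<Sum>s\<in>{s \<in> E. s \<le> b}. w s)
    = (\<Sum>s\<in>{s \<in> E. s < a}. w s) + (\<Sum>s\<in>{s \<in> E. a \<le> s \<and> s \<le> b}. w s)"
proof -
  have "{s \<in> E. s \<le> b} = {s \<in> E. s < a} \<union> {s \<in> E. a \<le> s \<and> s \<le> b}" using assms(2) by auto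
  moreover have "finite {s \<in> E. s < a}" "finite {s \<in> E. a \<le> s \<and> s \<le> b}"
    using assms by (auto elim!: rev_finite_subset)
  ultimately show ?thesis by (simp add: sum.union_disjoint disjoint_iff)
qed

text \<open>
  Hall's theorem for intervals with increasing end points, by greedy choice: each index is the
  least one that exceeds \<open>lo k\<close> and all previous indices. Unfolding this recursion gives the
  maximum in the definition of \<open>j\<close>.
\<close>
lemma strict_mono_selection:
  fixes lo hi :: "nat \<Rightarrow> nat"
  assumes hall: "\<And>a k. m0 \<le> a \<Longrightarrow> a \<le> k \<Longrightarrow> k \<le> m1 \<Longrightarrow> lo a + (k - a + 1) \<le> hi k"
  obtains j where "strict_mono_on {m0..m1} j" "\<And>k. k \<in> {m0..m1} \<Longrightarrow> lo k < j k \<and> j k \<le> hi k"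
proof -
  define j where "j k = Max ((\<lambda>a. lo a + (k - a + 1)) ` {m0..k})" for k
  have attained: "\<exists>a\<in>{m0..k}. j k = lo a + (k - a + 1)" if "m0 \<le> k" for k
  proof -
    have "j k \<in> (\<lambda>a. lo a + (k - a + 1)) ` {m0..k}"
      unfolding j_def using that by (intro Max_in) auto
    then show ?thesis by blast
  qed
  have ge: "lo a + (k - a + 1) \<le> j k" if "m0 \<le> a" "a \<le> k" for a k
    unfolding j_def using that by (intro Max_ge) auto
  show ?thesis
  proof (rule that)
    show "strict_mono_on {m0..m1} j"
    proof (rule strict_mono_onI)
      fix k l assume "k \<in> {m0..m1}" "l \<in> {m0..m1}" "k < l"
      then obtain a where "a \<in> {m0..k}" "j k = lo a + (k - a + 1)" using attained[of k] by auto
      then show "j k < j l" using ge[of a l] \<open>k < l\<close> by auto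
    qed
    show "lo k < j k \<and> j k \<le> hi k" if "k \<in> {m0..m1}" for k
      using attained[of k] hall ge[of k k] that by fastforce
  qed
qed

lemma sum_multiplicity_le_count:
  assumes "finite F" "F \<subseteq> E"
  shows "enat (\<Sum>s\<in>F. multiplicity_of D T s) \<le> eigenvalue_count D T E"
  unfolding eigenvalue_count_def using assms by (intro SUP_upper) simp

lemma orthogonal_projection_expansion:
  assumes "finite B" "orthonormal B" "complex_vector.span B = U"
  shows "orthogonal_projection U x = expansion B x"
  unfolding orthogonal_projection_def projection_along_def orthogonal_complement_def
proof (rule the_equality)
  show "expansion B x \<in> U \<and> x - expansion B x \<in> {x. \<forall>y\<in>U. cinner y x = 0}"
    using expansion_in_span[of B x] expansion_residual[OF assms(1,2)] assms(3) by blast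
  show "v = expansion B x" if "v \<in> U \<and> x - v \<in> {x. \<forall>y\<in>U. cinner y x = 0}" for v
    using expansion_unique[OF assms(1,2), of v x] that assms(3) by blast
qed

lemma bounded_linear_scaleC:
  assumes "bounded_linear f"
  shows "bounded_linear (\<lambda>x. f x *\<^sub>C v)"
proof -
  have "bounded_linear (\<lambda>c. c *\<^sub>C v)"
    by (rule bounded_linear_intro[where K = "norm v"])
      (simp_all add: scaleC_add_left scaleR_scaleC scaleC_scaleC scaleR_conv_of_real norm_scaleC)
  then show ?thesis using assms by (rule bounded_linear_compose)
qed

text \<open>
  The inverse \<open>A\<close> of \<open>H\<close> is symmetric, so \<open>\<langle>A u, H y\<rangle> = \<langle>u, y\<rangle>\<close>. Hence \<open>x - H y\<close> with \<open>y\<close> in \<open>U\<close> is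
  orthogonal to \<open>A U\<close> exactly if \<open>A x - y\<close> is orthogonal to \<open>U\<close>, that is, if \<open>y\<close> is the orthogonal
  projection of \<open>A x\<close>.
\<close>
lemma oblique_projection_eq:
  assumes sa: "self_adjoint D H" and inv: "has_bounded_inverse D H"
    and B: "finite B" "orthonormal B" "complex_vector.span B = U" and UD: "U \<subseteq> D"
  shows "projection_along (H ` U) (orthogonal_complement (inv_into D H ` U)) x
    = H (expansion B (inv_into D H x))"
proof -
  define A where "A = inv_into D H"
  have bij: "bij_betw H D UNIV" using inv by (simp add: has_bounded_inverse_def)
  have A: "A y \<in> D" "H (A y) = y" for y
    unfolding A_def using bij inv_into_into[of y H D] f_inv_into_f[of y H D]
    by (auto simp: bij_betw_def)
  have AH: "A (H y) = y" if "y \<in> D" for y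
    unfolding A_def using bij that by (simp add: bij_betw_def)
  note sym = self_adjoint_symmetric[OF sa]
  note lin = symmetric_operator_linear[OF sym]
  have AD: "cinner (A u) (H y) = cinner u y" if "y \<in> D" for u y
    using symmetric_operatorD[OF sym A(1)[of u] that] A(2) by simp
  have U: "complex_vector.subspace U" using B(3) complex_vector.subspace_span by blast
  define v where "v = H (expansion B (A x))"
  have e: "expansion B (A x) \<in> U" using expansion_in_span B(3) by blast
  have "cinner (A u) (x - v) = 0" if "u \<in> U" for u
  proof -
    have "cinner (A u) (x - v) = cinner (A u) (H (A x)) - cinner (A u) v"
      using A(2) by (simp add: cinner_diff_right)
    also have "\<dots> = cinner u (A x - expansion B (A x))"
      using AD A(1) e UD by (auto simp: v_def cinner_diff_right)
    also have "\<dots> = 0" using expansion_residual[OF B(1,2)] B(3) that by blast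
    finally show ?thesis .
  qed
  moreover have "w = v" if w: "w \<in> H ` U" "\<And>u. u \<in> U \<Longrightarrow> cinner (A u) (x - w) = 0" for w
  proof -
    obtain y where y: "y \<in> U" "w = H y" using w(1) by blast
    have "cinner u (A x - y) = 0" if "u \<in> U" for u
      using w(2)[OF that] AD[OF A(1)[of x]] AD[of y u] A(2) y UD by (auto simp: cinner_diff_right)
    then have "y = expansion B (A x)" using expansion_unique[OF B(1,2), of y "A x"] B(3) y by blast
    then show ?thesis by (simp add: y v_def)
  qed
  ultimately show ?thesis
    unfolding projection_along_def orthogonal_complement_def A_def[symmetric] v_def[symmetric]
    using e by (intro the_equality) (auto simp: v_def)
qed

text \<open>
  Boundedness is what makes the operator norm an actual bound, as it is defined as a supremum.
\<close>
lemma projection_difference_bounded_linear: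
  assumes sa: "self_adjoint D H" and inv: "has_bounded_inverse D H" and B: "finite B" "B \<subseteq> D"
  shows "bounded_linear (\<lambda>x. expansion B x - H (expansion B (inv_into D H x)))"
proof -
  have bl: "bounded_linear (inv_into D H)" using inv by (simp add: has_bounded_inverse_def)
  note lin = symmetric_operator_linear[OF self_adjoint_symmetric[OF sa]]
  have "H (expansion B y) = (\<Sum>b\<in>B. cinner b y *\<^sub>C H b)" for y
    unfolding expansion_def using B by (intro linear_operator_sum[OF lin]) auto
  then show ?thesis
    unfolding expansion_def
    by (auto intro!: bounded_linear_sub bounded_linear_sum bounded_linear_scaleC
        bounded_linear_cinner bounded_linear_compose[OF bounded_linear_cinner bl])
qed

text \<open>
  The multiplicities add up to the dimension, so the enumeration reaches every index up to it.
\<close>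
lemma finite_dimensional_nth_eigenvalue:
  assumes sym: "symmetric_operator X T" and fd: "finite_dimensional X" and inv: "T ` X \<subseteq> X"
    and k: "1 \<le> k" "k \<le> complex_vector.dim X"
  defines "E \<equiv> real_eigenvalues X T"
  defines "\<mu> \<equiv> nth_eigenvalue X T E"
  shows "(\<Sum>s\<in>{s \<in> E. s < \<mu> k}. multiplicity_of X T s) < k"
    "k \<le> (\<Sum>s\<in>{s \<in> E. s \<le> \<mu> k}. multiplicity_of X T s)"
proof -
  have fin: "finite E" unfolding E_def by (rule finite_dimensional_spectral_theorem[OF sym fd inv])
  \<comment> \<open>The additional \<open>0\<close> keeps the set nonempty; any upper bound of \<open>E\<close> would do.\<close>
  define b where "b = Max (insert 0 E)"
  have "{s \<in> E. s \<le> b} = E" using fin by (auto simp: b_def)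
  then have "k \<le> (\<Sum>s\<in>{s \<in> E. s \<le> b}. multiplicity_of X T s)"
    using finite_dimensional_spectral_theorem(2)[OF sym fd inv] k unfolding E_def by simp
  then show "(\<Sum>s\<in>{s \<in> E. s < \<mu> k}. multiplicity_of X T s) < k"
    "k \<le> (\<Sum>s\<in>{s \<in> E. s \<le> \<mu> k}. multiplicity_of X T s)"
    unfolding \<mu>_def using nth_eigenvalue_exists[of E b k X T] fin k by simp_all
qed

theorem theorem1p1:
  fixes D U V W :: "'a::chilbert_space set"
    and H M P :: "'a \<Rightarrow> 'a"
    and \<eta> :: real and d :: ereal and \<mu> lam :: "nat \<Rightarrow> real"
  assumes "self_adjoint D H"
    and "has_bounded_inverse D H"
    and "complex_vector.subspace U" and "finite_dimensional U" and "U \<subseteq> D"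
    and M_def: "M = (\<lambda>u. orthogonal_projection U (H u))"
    and mu_def: "\<mu> = nth_eigenvalue U M (real_eigenvalues U M)"
    and V_def: "V = H ` U"
    and W_def: "W = inv_into D H ` U"
    and P_def: "P = projection_along V (orthogonal_complement W)"
    and eta_def: "\<eta> = onorm (\<lambda>x. orthogonal_projection U x - P x)"
    and "\<eta> < 1"
    and d_def: "d = Inf (ereal ` {t. complex_of_real t \<in> essential_spectrum D H \<and> 0 < t})"
    and lam_def: "lam = nth_eigenvalue D H (positive_eigenvalues_below D H d)"
  shows "bij_betw M U U \<and>
    (\<forall>m0 m1. 1 \<le> m0 \<and> m0 \<le> m1 \<and> m1 \<le> complex_vector.dim U
        \<and> 0 < \<mu> m0 \<and> ereal (\<mu> m1) < ereal (1 - \<eta>) * d \<longrightarrow>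
      enat (m1 - m0 + 1) \<le> eigenvalue_count D H (positive_eigenvalues_below D H d) \<and>
      (\<exists>j. strict_mono_on {m0..m1} j \<and>
        (\<forall>k\<in>{m0..m1}. 1 \<le> j k
           \<and> enat (j k) \<le> eigenvalue_count D H (positive_eigenvalues_below D H d)
           \<and> \<bar>lam (j k) - \<mu> k\<bar> / lam (j k) \<le> \<eta>)))"
proof -
  note sa = assms(1) and inv = assms(2) and U = assms(3) and fd = assms(4) and UD = assms(5)
  note symH = self_adjoint_symmetric[OF sa]
  note linH = symmetric_operator_linear[OF symH]
  obtain B where B: "finite B" "orthonormal B" "B \<subseteq> U" "complex_vector.span B = U"
    by (rule orthonormal_basis_exists[OF U fd])
  have M_eq: "M u = expansion B (H u)" for u
    unfolding M_def using orthogonal_projection_expansion[OF B(1,2,4)] .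
  have MU: "M ` U \<subseteq> U" using expansion_in_span[of B] B(4) by (auto simp: M_eq)
  have orth: "cinner y (H x - M x) = 0" if "y \<in> U" for x y
    unfolding M_eq using expansion_residual[OF B(1,2)] B(4) that by blast
  have ip_M: "cinner y (M x) = cinner y (H x)" if "y \<in> U" for x y
    using orth[OF that, of x] by (simp add: cinner_diff_right)
  have linM: "linear_operator U M"
    unfolding linear_operator_def M_eq
    using U UD linear_operator_add[OF linH] linear_operator_scaleC[OF linH]
      linear_operator_add[OF expansion_linear] linear_operator_scaleC[OF expansion_linear]
    by (auto simp: subset_iff)
  have "cinner (M x) y = cinner x (M y)" if "x \<in> U" "y \<in> U" for x y
  proof -
    have "cinner (M x) y = cnj (cinner y (H x))" using ip_M[OF that(2)] by (metis cinner_commute)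
    also have "\<dots> = cinner (H x) y" by (metis cinner_commute)
    also have "\<dots> = cinner x (H y)" using symmetric_operatorD[OF symH] that UD by blast
    finally show ?thesis using ip_M[OF that(1)] by simp
  qed
  then have symM: "symmetric_operator U M" using linM by (simp add: symmetric_operator_def)

  have P_eq: "P x = H (expansion B (inv_into D H x))" for x
    unfolding P_def V_def W_def by (rule oblique_projection_eq[OF sa inv B(1,2,4) UD])
  have bl: "bounded_linear (\<lambda>x. orthogonal_projection U x - P x)"
    unfolding orthogonal_projection_expansion[OF B(1,2,4)] P_eq
    using projection_difference_bounded_linear[OF sa inv B(1)] B(3) UD by blast
  have \<eta>0: "0 \<le> \<eta>" unfolding eta_def by (rule onorm_pos_le[OF bl])
  have \<eta>1: "\<eta> < 1" by fact
  \<comment> \<open>On vectors \<open>H x\<close> with \<open>x\<close> in \<open>U\<close> the difference of the two projections is \<open>M x - H x\<close>.\<close>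
  have resid: "norm (H x - M x) \<le> \<eta> * norm (H x)" if "x \<in> U" for x
  proof -
    have "inj_on H D" using inv by (simp add: has_bounded_inverse_def bij_betw_def)
    then have "P (H x) = H x"
      using that UD expansion_id[OF B(1,2)] B(4) by (simp add: P_eq subset_iff)
    then have "norm (orthogonal_projection U (H x) - P (H x)) = norm (H x - M x)"
      by (simp add: M_def norm_minus_commute)
    then show ?thesis using onorm[OF bl, of "H x"] by (simp add: eta_def)
  qed

  have injM: "x = 0" if "x \<in> U" "M x = 0" for x
  proof -
    have "(1 - \<eta>) * norm (H x) \<le> 0" using resid[OF that(1)] that(2) by (simp add: algebra_simps)
    then have "H x = 0" using \<eta>1 by (simp add: mult_le_0_iff)
    moreover have "inj_on H D" using inv by (simp add: has_bounded_inverse_def bij_betw_def)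
    moreover have "H 0 = 0" "0 \<in> D" using linear_operator_zero[OF linH]
        complex_vector.subspace_0[OF linear_operator_subspace[OF linH]] by auto
    ultimately show "x = 0" using that UD by (metis inj_onD subsetD)
  qed
  have "inj_on M U"
  proof (rule inj_onI)
    fix x y assume "x \<in> U" "y \<in> U" "M x = M y"
    then have "M (x - y) = 0" "x - y \<in> U"
      using linear_operator_diff[OF linM] complex_vector.subspace_diff[OF U] by auto
    then show "x = y" using injM by fastforce
  qed
  then have "bij_betw M U U"
    using symmetric_injective_surjective[OF symM fd MU injM] by (simp add: bij_betw_def)
  moreover
  have "enat (m1 - m0 + 1) \<le> eigenvalue_count D H (positive_eigenvalues_below D H d) \<and>
      (\<exists>j. strict_mono_on {m0..m1} j \<and>
        (\<forall>k\<in>{m0..m1}. 1 \<le> j k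
           \<and> enat (j k) \<le> eigenvalue_count D H (positive_eigenvalues_below D H d)
           \<and> \<bar>lam (j k) - \<mu> k\<bar> / lam (j k) \<le> \<eta>))"
    if m: "1 \<le> m0" "m0 \<le> m1" "m1 \<le> complex_vector.dim U"
      and \<mu>m: "0 < \<mu> m0" "ereal (\<mu> m1) < ereal (1 - \<eta>) * d" for m0 m1
  proof -
    define E where "E = positive_eigenvalues_below D H d"
    define EM where "EM = real_eigenvalues U M"
    have finM: "finite EM"
      unfolding EM_def by (rule finite_dimensional_spectral_theorem[OF symM fd MU])
    have \<mu>_lt: "(\<Sum>s\<in>{s \<in> EM. s < \<mu> k}. multiplicity_of U M s) < k"
      and \<mu>_le: "k \<le> (\<Sum>s\<in>{s \<in> EM. s \<le> \<mu> k}. multiplicity_of U M s)"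
      if "m0 \<le> k" "k \<le> m1" for k
      unfolding EM_def mu_def
      by (rule finite_dimensional_nth_eigenvalue[OF symM fd MU]; use m that in linarith)+
    have \<mu>_mono: "\<mu> a \<le> \<mu> k" if "m0 \<le> a" "a \<le> k" "k \<le> m1" for a k
    proof (rule less_index_imp_le)
      show "finite {s \<in> EM. s < \<mu> a}" using finM by simp
      show "(\<Sum>s\<in>{s \<in> EM. s < \<mu> a}. multiplicity_of U M s) < k"
        using \<mu>_lt[of a] that by linarith
      show "k \<le> (\<Sum>s\<in>{s \<in> EM. s \<le> \<mu> k}. multiplicity_of U M s)"
        using \<mu>_le[of k] that by linarith
    qed
    have \<mu>_pos: "0 < \<mu> k" if "m0 \<le> k" "k \<le> m1" for k
      using \<mu>_mono[of m0 k] \<mu>m(1) that by linarith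
    define \<alpha> where "\<alpha> k = \<mu> k / (1 + \<eta>)" for k
    define \<beta> where "\<beta> k = \<mu> k / (1 - \<eta>)" for k
    have \<alpha>_pos: "0 < \<alpha> k" if "m0 \<le> k" "k \<le> m1" for k
      using \<mu>_pos[OF that] \<eta>0 by (simp add: \<alpha>_def)
    have \<alpha>_le_\<beta>: "\<alpha> a \<le> \<beta> k" if "m0 \<le> a" "a \<le> k" "k \<le> m1" for a k
      unfolding \<alpha>_def \<beta>_def
      using \<mu>_mono[OF that] \<mu>_pos[of a] that \<eta>0 \<eta>1 by (intro frac_le) auto
    have \<beta>_d: "ereal (\<beta> k) < d" if "m0 \<le> k" "k \<le> m1" for k
    proof -
      have "\<beta> k \<le> \<mu> m1 / (1 - \<eta>)"
        unfolding \<beta>_def using \<mu>_mono[of k m1] that \<eta>1 by (intro divide_right_mono) auto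
      moreover have "ereal (\<mu> m1 / (1 - \<eta>)) < d"
        using \<mu>m(2) \<eta>1 by (cases d) (auto simp: field_simps)
      ultimately show ?thesis by (meson ereal_less_eq(3) le_less_trans)
    qed
    \<comment> \<open>Including \<open>t = 0\<close>, where \<open>H\<close> has a bounded inverse, keeps the eigenvalues from accumulating at \<open>0\<close>.\<close>
    have ess: "complex_of_real t \<notin> essential_spectrum D H" if "0 \<le> t" "ereal t < d" for t
    proof (cases "t = 0")
      case True
      then show ?thesis using inv by (simp add: essential_spectrum_def spectrum_def)
    next
      case False
      show ?thesis
      proof
        assume "complex_of_real t \<in> essential_spectrum D H"
        then have "d \<le> ereal t" unfolding d_def using that False by (intro Inf_lower) auto
        then show False using that(2) by simp
      qed
    qed
    have E_eq: "{s \<in> E. a \<le> s \<and> s \<le> b} = {s \<in> real_eigenvalues D H. a \<le> s \<and> s \<le> b}"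
      if "0 < a" "ereal b < d" for a b
      using that le_less_trans[of "ereal _" "ereal b" d]
      by (auto simp: E_def positive_eigenvalues_below_def)
    have finE: "finite {s \<in> E. s \<le> b}" if "ereal b < d" for b
    proof (rule finite_subset)
      show "{s \<in> E. s \<le> b} \<subseteq> {s \<in> real_eigenvalues D H. 0 \<le> s \<and> s \<le> b}"
        by (auto simp: E_def positive_eigenvalues_below_def)
      show "finite {s \<in> real_eigenvalues D H. 0 \<le> s \<and> s \<le> b}"
        using that le_less_trans[of "ereal _" "ereal b" d]
        by (intro finite_eigenvalues_non_essential[OF sa ess]) auto
    qed
    define lo where "lo a = (\<Sum>s\<in>{s \<in> E. s < \<alpha> a}. multiplicity_of D H s)" for a
    define hi where "hi k = (\<Sum>s\<in>{s \<in> E. s \<le> \<beta> k}. multiplicity_of D H s)" for k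
    \<comment> \<open>The eigenvalues of \<open>M\<close> with indices from \<open>a\<close> to \<open>k\<close> are \<open>k - a + 1\<close> many and lie in \<open>[\<mu> a, \<mu> k]\<close>.\<close>
    have hall: "lo a + (k - a + 1) \<le> hi k" if ak: "m0 \<le> a" "a \<le> k" "k \<le> m1" for a k
    proof -
      have bd: "ereal (\<beta> k) < d" using \<beta>_d ak by simp
      have "k \<le> (\<Sum>s\<in>{s \<in> EM. s < \<mu> a}. multiplicity_of U M s)
          + (\<Sum>s\<in>{s \<in> EM. \<mu> a \<le> s \<and> s \<le> \<mu> k}. multiplicity_of U M s)"
        using \<mu>_le[of k] sum_le_split[of EM "\<mu> k" "\<mu> a"] finM \<mu>_mono[OF ak] ak by simp
      then have "k - a + 1 \<le> (\<Sum>s\<in>{s \<in> EM. \<mu> a \<le> s \<and> s \<le> \<mu> k}. multiplicity_of U M s)"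
        using \<mu>_lt[of a] ak by linarith
      also have "\<dots> \<le> (\<Sum>s\<in>{s \<in> real_eigenvalues D H. \<alpha> a \<le> s \<and> s \<le> \<beta> k}. multiplicity_of D H s)"
        unfolding EM_def \<alpha>_def \<beta>_def
      proof (rule compression_eigenvalue_count[OF sa symM fd UD MU orth resid \<eta>0 \<eta>1])
        show "0 < \<mu> a" "\<mu> a \<le> \<mu> k" using \<mu>_pos[of a] \<mu>_mono[OF ak] ak by auto
        fix t assume "\<mu> a / (1 + \<eta>) \<le> t" "t \<le> \<mu> k / (1 - \<eta>)"
        then show "complex_of_real t \<notin> essential_spectrum D H"
          using \<alpha>_pos[of a] ak le_less_trans[of "ereal t" "ereal (\<beta> k)" d] bd
          by (intro ess) (auto simp: \<alpha>_def \<beta>_def)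
      qed
      also have "\<dots> = (\<Sum>s\<in>{s \<in> E. \<alpha> a \<le> s \<and> s \<le> \<beta> k}. multiplicity_of D H s)"
        using E_eq[OF \<alpha>_pos bd] ak by simp
      finally show ?thesis
        unfolding lo_def hi_def using sum_le_split[OF finE[OF bd] \<alpha>_le_\<beta>[OF ak]] by simp
    qed
    have count: "enat n \<le> eigenvalue_count D H E" if "n \<le> hi k" "m0 \<le> k" "k \<le> m1" for n k
    proof -
      have "enat (hi k) \<le> eigenvalue_count D H E"
        unfolding hi_def using finE[OF \<beta>_d] that by (intro sum_multiplicity_le_count) auto
      then show ?thesis using that(1) by (meson enat_ord_simps(1) order.trans)
    qed
    obtain j where j: "strict_mono_on {m0..m1} j"
      and j_bounds: "\<forall>k\<in>{m0..m1}. lo k < j k \<and> j k \<le> hi k"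
      using strict_mono_selection[of m0 m1 lo hi] hall by metis
    have "1 \<le> j k \<and> enat (j k) \<le> eigenvalue_count D H E \<and> \<bar>lam (j k) - \<mu> k\<bar> / lam (j k) \<le> \<eta>"
      if k: "k \<in> {m0..m1}" for k
    proof -
      have bd: "ereal (\<beta> k) < d" and kk: "m0 \<le> k" "k \<le> m1" using \<beta>_d k by auto
      have jk: "lo k < j k" "j k \<le> hi k" using j_bounds k by auto
      have fin: "finite {s \<in> E. s \<le> t}" if "t \<in> E" for t
        using that finE by (simp add: E_def positive_eigenvalues_below_def)
      have lamE: "lam = nth_eigenvalue D H E" by (simp add: lam_def E_def)
      have "0 < j k" using jk by simp
      note nth = nth_eigenvalue_exists[of E "\<beta> k" "j k" D H, OF fin finE[OF bd] \<open>0 < j k\<close>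
          jk(2)[unfolded hi_def], folded lamE]
      have "finite {s \<in> E. s < \<alpha> k}"
        using finE[OF bd] \<alpha>_le_\<beta>[of k k] kk by (elim rev_finite_subset) auto
      then have "\<alpha> k \<le> lam (j k)"
        using less_index_imp_le[of E "\<alpha> k" "multiplicity_of D H" "j k" "lam (j k)"] jk(1) nth(4)
        by (simp add: lo_def)
      moreover have "lam (j k) \<le> \<beta> k" by (rule nth(2))
      moreover have "0 < lam (j k)" using \<alpha>_pos[OF kk] calculation by linarith
      ultimately have "\<bar>lam (j k) - \<mu> k\<bar> / lam (j k) \<le> \<eta>"
        using \<eta>0 \<eta>1 by (simp add: \<alpha>_def \<beta>_def field_simps abs_le_iff)
      then show ?thesis using \<open>0 < j k\<close> count[OF jk(2) kk] by simp
    qed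
    moreover have "enat (m1 - m0 + 1) \<le> eigenvalue_count D H E"
      using count[of _ m1] hall[of m0 m1] m by simp
    ultimately show ?thesis using j unfolding E_def[symmetric] by blast
  qed
  ultimately show ?thesis by blast
qed

end
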